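(* Let $\psi:\mathbb{R}\to\mathbb{R}$ be convex and differentiable with $\int e^{-\psi(z)}\mathrm{d}z=1$, $\int ze^{-\psi(z)}\mathrm{d}z=0$, $\int z^2e^{-\psi(z)}\mathrm{d}z=1$. Let $n\ge1$, $\Omega\subseteq\{1,\dots,n\}$, and suppose that $\sigma>0$ satisfies $\tau(\sigma)<1$, that the real number $M$ satisfies $$M\ge2\exp\Big\{\frac{\psi(0)}2\Big\}\sup_{z\le\kappa(\sigma)}\exp\Big\{-\frac{\psi(z)}2\Big\}\Big(1-\frac{\psi'(z)}\sigma\Big),$$ and that $N=M\log(2/\epsilon)/(1-\tau(\sigma))$ with $\epsilon\in(0,1)$. Then there is a randomized algorithm $h:(\mathbb{R}\cup\{\star\})^n\to(\mathbb{R}\cup\{\star\})^n$ running in time $O\big(|\Omega|N(T_{samp}+T_{eval})\big)$ such that for every $\theta^\star\in\mathbb{R}^n$ the following holds. Let $$y_i=\begin{cases}\theta^\star_i+\xi_i,&i\in\Omega,\\\star,&i\notin\Omega,\end{cases}\qquad\widetilde y_i=\begin{cases}\theta^\star_i+\varepsilon_i,&i\in\Omega,\\\star,&i\notin\Omega,\end{cases}$$ where $\{\xi_i\}_{i\in\Omega}$ are i.i.d. with density $e^{-x-1}$ for $x\ge-1$ and $0$ for $x<-1$, and $\{\varepsilon_i\}_{i\in\Omega}$ are i.i.d. with density $\frac1\sigma\exp\{-\psi(z/\sigma)\}$. Then $$\mathsf{d_{TV}}\Big(h\big(\{y_i\}_{i=1}^n\big),\{\widetilde y_i\}_{i=1}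^n\Big)\le|\Omega|\cdot\big(\epsilon+\tau(\sigma)\big).$$
   Context: $\star$ is a symbol denoting an unobserved entry. $\kappa(\sigma)=\inf\{z\in\mathbb{R}:\psi'(z)=\sigma\}$ if some $z\in\mathbb{R}$ satisfies $\psi'(z)=\sigma$, and $+\infty$ otherwise; $\tau(\sigma)=2\int_{\kappa(\sigma)}^{+\infty}e^{-\psi(z)}\mathrm{d}z+\frac2\sigma e^{-\psi(\kappa(\sigma))}$, read as $0$ when $\kappa(\sigma)=+\infty$. $\mathsf{d_{TV}}$ is total variation distance between laws. A randomized algorithm is a Markov kernel; it does not have access to $\theta^\star$. $T_{samp}$ is the time to sample from the density $y\mapsto\frac1{2\sigma}\exp\{-\psi(\frac{y-x-1}{2\sigma})\}$ for a given $x$; $T_{eval}$ is the time to evaluate at a single point $(x,y)$ the function $v(y;x+1)-\nabla_\theta v(y;\theta)|_{\theta=x+1}$, where $v(y;\theta)=\frac1\sigma\exp\{-\psi(\frac{y-\theta}\sigma)\}$; other elementary operations cost $O(1)$, and leaving unobserved entries as they are is free. *)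

theory Defs
  imports "HOL-Probability.Probability"
begin

text \<open>The unobserved entry is \<^term>\<open>None\<close>; a set of possibly unobserved reals is measurable
  iff its observed part is Borel.\<close>

definition star_borel :: "real option measure" where
  "star_borel = sigma UNIV {A. Some -` A \<in> sets borel}"

definition obs_space :: "nat \<Rightarrow> (nat \<Rightarrow> real option) measure" where
  "obs_space n = (\<Pi>\<^sub>M i\<in>{1..n}. star_borel)"

definition tv_dist :: "'a measure \<Rightarrow> 'a measure \<Rightarrow> real" where
  "tv_dist P Q = (SUP A\<in>sets P. \<bar>measure P A - measure Q A\<bar>)"

definition kappa :: "(real \<Rightarrow> real) \<Rightarrow> real \<Rightarrow> ereal" where
  "kappa \<psi> \<sigma> =
     (if \<exists>z. deriv \<psi> z = \<sigma> then ereal (Inf {z. deriv \<psi> z = \<sigma>}) else \<infinity>)"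

definition tau :: "(real \<Rightarrow> real) \<Rightarrow> real \<Rightarrow> real" where
  "tau \<psi> \<sigma> =
     (if kappa \<psi> \<sigma> = \<infinity> then 0
      else let k = real_of_ereal (kappa \<psi> \<sigma>) in
        2 * (LINT z:{k..}|lborel. exp (- \<psi> z)) + 2 / \<sigma> * exp (- \<psi> k))"

definition target_density :: "(real \<Rightarrow> real) \<Rightarrow> real \<Rightarrow> real \<Rightarrow> real \<Rightarrow> real" where
  "target_density \<psi> \<sigma> y \<theta> = 1 / \<sigma> * exp (- \<psi> ((y - \<theta>) / \<sigma>))"

definition signed_kernel :: "(real \<Rightarrow> real) \<Rightarrow> real \<Rightarrow> real \<Rightarrow> real \<Rightarrow> real" where
  "signed_kernel \<psi> \<sigma> x y =
     target_density \<psi> \<sigma> y (x + 1) - deriv (\<lambda>\<theta>. target_density \<psi> \<sigma> y \<theta>) (x + 1)"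

definition base_measure :: "(real \<Rightarrow> real) \<Rightarrow> real \<Rightarrow> real \<Rightarrow> real measure" where
  "base_measure \<psi> \<sigma> x =
     density lborel (\<lambda>y. ennreal (1 / (2 * \<sigma>) * exp (- \<psi> ((y - x - 1) / (2 * \<sigma>)))))"

definition source_noise :: "real measure" where
  "source_noise = density lborel (\<lambda>x. ennreal (if x \<ge> -1 then exp (- x - 1) else 0))"

definition target_noise :: "(real \<Rightarrow> real) \<Rightarrow> real \<Rightarrow> real measure" where
  "target_noise \<psi> \<sigma> = density lborel (\<lambda>z. ennreal (1 / \<sigma> * exp (- \<psi> (z / \<sigma>))))"

definition observe ::
  "nat \<Rightarrow> nat set \<Rightarrow> (nat \<Rightarrow> real) \<Rightarrow> (nat \<Rightarrow> real) \<Rightarrow> (nat \<Rightarrow> real option)" where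
  "observe n \<Omega> \<theta> \<xi> = (\<lambda>i\<in>{1..n}. if i \<in> \<Omega> then Some (\<theta> i + \<xi> i) else None)"

text \<open>Law of the observation vector when the noise family indexed by \<^term>\<open>\<Omega>\<close> is i.i.d. with
  law \<^term>\<open>\<nu>\<close>.\<close>

definition obs_law ::
  "real measure \<Rightarrow> nat \<Rightarrow> nat set \<Rightarrow> (nat \<Rightarrow> real) \<Rightarrow> (nat \<Rightarrow> real option) measure" where
  "obs_law \<nu> n \<Omega> \<theta> = distr (\<Pi>\<^sub>M i\<in>\<Omega>. \<nu>) (obs_space n) (observe n \<Omega> \<theta>)"

text \<open>Randomized algorithms are programs of a real-number machine (registers for reals, real
  constants, arithmetic, comparison, uniform random numbers, counted loops) that transforms the
  observation vector in place. The function \<^term>\<open>\<psi>\<close> is accessible only through the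
  instructions \<open>Sample\<close> (a draw from \<^term>\<open>base_measure \<psi> \<sigma> x\<close>) and \<open>Eval\<close>
  (the value \<^term>\<open>signed_kernel \<psi> \<sigma> x y\<close>). The first argument of an instruction that
  computes a value is the destination register; the arguments \<open>x\<close>, \<open>y\<close>, \<open>a\<close>, \<open>b\<close> are registers
  holding the operands.\<close>

datatype arith_op = Add | Sub | Mul | Div

primrec arith :: "arith_op \<Rightarrow> real \<Rightarrow> real \<Rightarrow> real" where
  "arith Add u v = u + v"
| "arith Sub u v = u - v"
| "arith Mul u v = u * v"
| "arith Div u v = u / v"

datatype cmd =
    Skip
  | Const nat real
  | Arith nat arith_op nat nat
  | Load nat nat      \<comment> \<open>register, position in the vector\<close>
  | Store nat nat     \<comment> \<open>position in the vector, register\<close>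
  | Uniform nat
  | Sample nat nat
  | Eval nat nat nat
  | Seq cmd cmd
  | IfLe nat nat cmd cmd
  | Repeat nat cmd    \<comment> \<open>the number of rounds is part of the program text\<close>

type_synonym state = "(nat \<Rightarrow> real) \<times> (nat \<Rightarrow> real option)"

definition state_space :: "nat \<Rightarrow> state measure" where
  "state_space n = (\<Pi>\<^sub>M r\<in>UNIV. borel) \<Otimes>\<^sub>M obs_space n"

text \<open>Loading an unobserved entry yields 0; storing outside the vector has no effect.\<close>

primrec sem :: "(real \<Rightarrow> real) \<Rightarrow> real \<Rightarrow> nat \<Rightarrow> cmd \<Rightarrow> state \<Rightarrow> state measure" where
  "sem \<psi> \<sigma> n Skip = (\<lambda>s. return (state_space n) s)"
| "sem \<psi> \<sigma> n (Const r c) = (\<lambda>(R, w). return (state_space n) (R(r := c), w))"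
| "sem \<psi> \<sigma> n (Arith r f a b) =
     (\<lambda>(R, w). return (state_space n) (R(r := arith f (R a) (R b)), w))"
| "sem \<psi> \<sigma> n (Load r i) =
     (\<lambda>(R, w). return (state_space n)
        (R(r := (if i \<in> {1..n} then case w i of None \<Rightarrow> 0 | Some v \<Rightarrow> v else 0)), w))"
| "sem \<psi> \<sigma> n (Store i r) =
     (\<lambda>(R, w). return (state_space n) (R, if i \<in> {1..n} then w(i := Some (R r)) else w))"
| "sem \<psi> \<sigma> n (Uniform r) =
     (\<lambda>(R, w). distr (uniform_measure lborel {0..1}) (state_space n) (\<lambda>u. (R(r := u), w)))"
| "sem \<psi> \<sigma> n (Sample r x) =
     (\<lambda>(R, w). distr (base_measure \<psi> \<sigma> (R x)) (state_space n) (\<lambda>v. (R(r := v), w)))"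
| "sem \<psi> \<sigma> n (Eval r x y) =
     (\<lambda>(R, w). return (state_space n) (R(r := signed_kernel \<psi> \<sigma> (R x) (R y)), w))"
| "sem \<psi> \<sigma> n (Seq c d) = (\<lambda>s. sem \<psi> \<sigma> n c s \<bind> sem \<psi> \<sigma> n d)"
| "sem \<psi> \<sigma> n (IfLe a b c d) =
     (\<lambda>s. if fst s a \<le> fst s b then sem \<psi> \<sigma> n c s else sem \<psi> \<sigma> n d s)"
| "sem \<psi> \<sigma> n (Repeat k c) =
     (\<lambda>s. ((\<lambda>m. m \<bind> sem \<psi> \<sigma> n c) ^^ k) (return (state_space n) s))"

text \<open>Worst-case running time, in units of one elementary operation.\<close>

primrec run_time :: "real \<Rightarrow> real \<Rightarrow> cmd \<Rightarrow> real" where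
  "run_time T\<^sub>s T\<^sub>e Skip = 0"
| "run_time T\<^sub>s T\<^sub>e (Const r c) = 1"
| "run_time T\<^sub>s T\<^sub>e (Arith r f a b) = 1"
| "run_time T\<^sub>s T\<^sub>e (Load r i) = 1"
| "run_time T\<^sub>s T\<^sub>e (Store i r) = 1"
| "run_time T\<^sub>s T\<^sub>e (Uniform r) = 1"
| "run_time T\<^sub>s T\<^sub>e (Sample r x) = T\<^sub>s"
| "run_time T\<^sub>s T\<^sub>e (Eval r x y) = T\<^sub>e"
| "run_time T\<^sub>s T\<^sub>e (Seq c d) = run_time T\<^sub>s T\<^sub>e c + run_time T\<^sub>s T\<^sub>e d"
| "run_time T\<^sub>s T\<^sub>e (IfLe a b c d) = 1 + max (run_time T\<^sub>s T\<^sub>e c) (run_time T\<^sub>s T\<^sub>e d)"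
| "run_time T\<^sub>s T\<^sub>e (Repeat k c) = real k * (1 + run_time T\<^sub>s T\<^sub>e c)"

text \<open>The program starts with all registers 0 and the input in the vector; its output is the final
  vector.\<close>

definition computes ::
  "(real \<Rightarrow> real) \<Rightarrow> real \<Rightarrow> nat \<Rightarrow> cmd \<Rightarrow>
   ((nat \<Rightarrow> real option) \<Rightarrow> (nat \<Rightarrow> real option) measure) \<Rightarrow> bool" where
  "computes \<psi> \<sigma> n c h \<longleftrightarrow>
     (\<forall>w\<in>space (obs_space n). h w = distr (sem \<psi> \<sigma> n c (\<lambda>_. 0, w)) (obs_space n) snd)"

end

theory Submission
  imports Defs
begin

text \<open>With \<open>f z = exp (- \<psi> z)\<close> and \<open>s z = f z * (1 - \<psi>' z / \<sigma>)\<close>, the signed kernel at \<open>(x, y)\<close> is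
  \<open>s z / \<sigma>\<close> for \<open>y = x + 1 + \<sigma> * z\<close>, and averaging it over exponential noise in \<open>x\<close> gives exactly the
  target density. The algorithm samples, in each observed coordinate, from the normalized positive part
  of \<open>s\<close> by rejection. Since \<open>s\<close> is at most its positive part, the output law dominates
  \<open>c ^ card \<Omega>\<close> times the target law, where \<open>c = (1 - P(no acceptance)) / \<integral>s\<^sup>+\<close>; hence the total
  variation distance is at most \<open>1 - c ^ card \<Omega> \<le> card \<Omega> * (1 - c)\<close>, and
  \<open>\<integral>s\<^sup>+ \<le> 1 + f (\<kappa> \<sigma>) / \<sigma> \<le> 1 + \<tau> \<sigma>\<close>.

  The machine cannot evaluate the density of \<open>Sample\<close>, so the proposal is a fixed heavy-tailed law with
  density \<open>1 / (2 * (1 + \<bar>z\<bar>)\<^sup>2)\<close>. An isotropic log-concave density satisfies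
  \<open>(1 + \<bar>z\<bar>)\<^sup>2 * sqrt (f z * f 0) \<le> C\<close> with a universal \<open>C\<close>, so \<open>C * M\<close> is an envelope
  constant for this proposal.\<close>

section \<open>Isotropic log-concave densities\<close>

text \<open>The constant \<open>C\<close> of the running time is chosen before \<open>\<psi>\<close>
  and \<open>\<sigma>\<close>, so a single proposal has to serve every isotropic log-concave
  density. The hypothesis on \<open>M\<close> controls one factor
  \<open>exp (- \<psi> z / 2)\<close> times the slope factor; the second factor
  \<open>exp (- \<psi> z / 2)\<close> must be absorbed by the proposal, at a cost that depends on
  \<open>\<psi>\<close> only through \<open>\<psi> 0\<close>. Mean 0 and variance 1 make this
  possible: they fix location and scale, which bounds the peak and forces a quadratic tail. That
  tail explains the inverse-square decay of the proposal, and a law of this shape can be drawn and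
  evaluated by rational operations alone. All estimates on programs are one-sided: the integral of a
  nonnegative test function after a run is bounded from below. The contribution of runs in which
  every trial fails is nonnegative and is dropped, so no value has to be specified for that event
  and the exact output law is never computed.\<close>

lemma has_bochner_integral_mono:
  fixes a b :: real
  assumes "has_bochner_integral M g a" "has_bochner_integral M h b" "\<And>x. g x \<le> h x"
  shows "a \<le> b"
  using integral_mono[of M g h] assms by (simp add: has_bochner_integral_iff)

locale isotropic_log_concave =
  fixes \<psi> :: "real \<Rightarrow> real"
  assumes convex: "convex_on UNIV \<psi>"
    and differentiable: "\<And>z. \<psi> differentiable (at z)"
    and mass: "has_bochner_integral lborel (\<lambda>z. exp (- \<psi> z)) 1"
    and mean: "has_bochner_integral lborel (\<lambda>z. z * exp (- \<psi> z)) 0"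
    and second_moment: "has_bochner_integral lborel (\<lambda>z. z\<^sup>2 * exp (- \<psi> z)) 1"
begin

abbreviation f :: "real \<Rightarrow> real" where "f z \<equiv> exp (- \<psi> z)"

lemma DERIV_psi: "DERIV \<psi> z :> deriv \<psi> z"
  using differentiable by (simp add: DERIV_deriv_iff_real_differentiable)

lemma continuous_psi: "continuous_on UNIV \<psi>"
  using DERIV_psi DERIV_isCont continuous_at_imp_continuous_on by blast

lemma psi_measurable [measurable]: "\<psi> \<in> borel_measurable borel"
  using continuous_psi by (rule borel_measurable_continuous_onI)

lemma psi_le_segment:
  assumes "0 \<le> t" "t \<le> 1"
  shows "\<psi> ((1 - t) * x + t * y) \<le> (1 - t) * \<psi> x + t * \<psi> y"
  using convex_onD[OF convex assms] by simp

lemma density_quasiconcave: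
  assumes "z \<in> closed_segment x y"
  shows "min (f x) (f y) \<le> f z"
proof -
  obtain t where t: "0 \<le> t" "t \<le> 1" "z = (1 - t) * x + t * y"
    using assms by (auto simp: closed_segment_def)
  have "\<psi> z \<le> (1 - t) * \<psi> x + t * \<psi> y" using psi_le_segment t by simp
  also have "\<dots> \<le> (1 - t) * max (\<psi> x) (\<psi> y) + t * max (\<psi> x) (\<psi> y)"
    using t by (intro add_mono mult_left_mono) auto
  finally have "\<psi> z \<le> max (\<psi> x) (\<psi> y)" by (simp add: algebra_simps)
  then show ?thesis by (auto simp: min_def max_def split: if_splits)
qed

lemma density_midpoint: "f x * f y \<le> (f ((x + y) / 2))\<^sup>2"
proof -
  have "\<psi> ((x + y) / 2) \<le> (\<psi> x + \<psi> y) / 2"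
    using psi_le_segment[of "1/2" x y] by (simp add: field_simps)
  then have "exp (- \<psi> x + - \<psi> y) \<le> exp (2 * - \<psi> ((x + y) / 2))" by simp
  then show ?thesis by (simp only: exp_add exp_double)
qed

text \<open>Chebyshev: at most 1/4 of the mass lies outside [-2, 2]. A density below 1/8 on this
  interval of length 4 would leave a total mass of at most 3/4.\<close>

lemma density_bulk: "\<exists>a\<in>{-2..2}. 1 / 8 \<le> f a"
proof (rule ccontr)
  assume "\<not> ?thesis"
  then have small: "f a < 1 / 8" if "-2 \<le> a" "a \<le> 2" for a using that by force
  have ineq: "f z \<le> 1/8 * indicator {-2..2} z + 1/4 * (z\<^sup>2 * f z)" for z
  proof (cases "z \<in> {-2..2}")
    case True then show ?thesis using small[of z] by (simp add: add_increasing2 less_imp_le)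
  next
    case False
    then have "\<bar>2\<bar> \<le> \<bar>z\<bar>" by auto
    then have "2\<^sup>2 \<le> z\<^sup>2" by (simp only: abs_le_square_iff)
    then have "1 * f z \<le> (1/4 * z\<^sup>2) * f z" by (intro mult_right_mono) auto
    then show ?thesis using False by simp
  qed
  have i: "has_bochner_integral lborel (indicator {-2..2::real} :: real \<Rightarrow> real) 4"
    using has_bochner_integral_real_indicator[of "{-2..2::real}" lborel] by simp
  have "has_bochner_integral lborel (\<lambda>z. 1/8 * indicator {-2..2} z + 1/4 * (z\<^sup>2 * f z)) (1/8 * 4 + 1/4 * 1)"
    by (intro has_bochner_integral_add has_bochner_integral_mult_right i second_moment)
  then have "1 \<le> 1/8 * 4 + 1/4 * (1::real)"
    by (rule has_bochner_integral_mono[OF mass _ ineq])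
  then show False by simp
qed

text \<open>Between the bulk and a far point \<open>w\<close> the density is at least \<open>min (f a) (f w)\<close>, and the
  second moment bounds the mass of a unit interval next to \<open>w\<close>.\<close>

lemma density_tail:
  assumes "5 \<le> \<bar>w\<bar>"
  shows "f w \<le> 9 / (4 * w\<^sup>2)"
proof -
  obtain a where a: "-2 \<le> a" "a \<le> 2" "1 / 8 \<le> f a" using density_bulk by auto
  \<comment> \<open>The unit interval with end \<open>w\<close> on the side of the origin. It lies
    between \<open>a\<close> and \<open>w\<close> since |a| \<le> 2 and |w| \<ge> 5, and there |z|
    \<ge> |w| - 1 \<ge> 2/3 |w|.\<close>
  define l where "l = (if 0 \<le> w then w - 1 else w)"
  define c where "c = min (f a) (f w)"
  have c_nonneg: "0 \<le> c" by (simp add: c_def)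
  have ineq: "c * (4 * w\<^sup>2 / 9) * indicator {l..l + 1} z \<le> z\<^sup>2 * f z" for z
  proof (cases "z \<in> {l..l + 1}")
    case True
    then have "z \<in> closed_segment a w"
      using a assms by (auto simp: l_def closed_segment_eq_real_ivl split: if_splits)
    then have c: "c \<le> f z" using density_quasiconcave by (simp add: c_def)
    have "\<bar>2 / 3 * w\<bar> \<le> \<bar>z\<bar>"
      using True assms by (auto simp: l_def split: if_splits)
    then have "(2 / 3 * w)\<^sup>2 \<le> z\<^sup>2" by (simp only: abs_le_square_iff)
    then have "4 * w\<^sup>2 / 9 \<le> z\<^sup>2" by (simp add: power_mult_distrib power_divide)
    then have "c * (4 * w\<^sup>2 / 9) \<le> f z * z\<^sup>2" using c c_nonneg by (intro mult_mono) auto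
    then show ?thesis using True by (simp add: mult.commute)
  qed (simp add: c_nonneg)
  have "has_bochner_integral lborel (indicator {l..l + 1} :: real \<Rightarrow> real) 1"
    using has_bochner_integral_real_indicator[of "{l..l + 1}" lborel] by simp
  then have "has_bochner_integral lborel (\<lambda>z. c * (4 * w\<^sup>2 / 9) * indicator {l..l + 1} z) (c * (4 * w\<^sup>2 / 9) * 1)"
    by (intro has_bochner_integral_mult_right)
  from has_bochner_integral_mono[OF this second_moment ineq]
  have le1: "c * w\<^sup>2 \<le> 9 / 4" by simp
  have "\<bar>5\<bar> \<le> \<bar>w\<bar>" using assms by simp
  then have w2: "5\<^sup>2 \<le> w\<^sup>2" by (simp only: abs_le_square_iff)
  \<comment> \<open>Otherwise \<open>c\<close> would be \<open>f a\<close>, at least 1/8, and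
    \<open>c\<close> times the square of \<open>w\<close> would be at least 25/8 > 9/4.\<close>
  have "c = f w"
  proof (rule ccontr)
    assume "c \<noteq> f w"
    then have "1 / 8 \<le> c" using a by (auto simp: c_def min_def split: if_splits)
    then have "1 / 8 * 5\<^sup>2 \<le> c * w\<^sup>2" using w2 c_nonneg by (intro mult_mono) auto
    then show False using le1 by simp
  qed
  then have "f w * (4 * w\<^sup>2) \<le> 9" using le1 by simp
  then show ?thesis using w2 by (intro mult_imp_le_div_pos) auto
qed

text \<open>Without a drop by the factor e, quasiconcavity would keep the density above
  \<open>f w * exp (-1)\<close> on an interval of length \<open>4 / f w\<close>, whose mass 4/e
  exceeds 1.\<close>

lemma density_drop:
  assumes "r = 4 / f w" and s: "s = 1 \<or> s = -1"
  shows "f (w + s * r) \<le> f w * exp (-1)"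
proof (rule ccontr)
  assume "\<not> ?thesis"
  then have big: "f w * exp (-1) < f (w + s * r)" by simp
  define l where "l = min w (w + s * r)"
  have r: "0 < r" using assms by simp
  have ineq: "f w * exp (-1) * indicator {l..l + r} z \<le> f z" for z
  proof (cases "z \<in> {l..l + r}")
    case True
    then have "z \<in> closed_segment w (w + s * r)"
      using s r by (auto simp: l_def closed_segment_eq_real_ivl min_def split: if_splits)
    then have "min (f w) (f (w + s * r)) \<le> f z" by (rule density_quasiconcave)
    moreover have "f w * exp (-1) \<le> f w * 1" by (intro mult_left_mono) auto
    ultimately have "f w * exp (-1) \<le> f z" using big by linarith
    then show ?thesis using True by simp
  qed simp
  have "has_bochner_integral lborel (indicator {l..l + r} :: real \<Rightarrow> real) r"
    using has_bochner_integral_real_indicator[of "{l..l + r}" lborel] r by simp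
  then have "has_bochner_integral lborel (\<lambda>z. f w * exp (-1) * indicator {l..l + r} z) (f w * exp (-1) * r)"
    by (intro has_bochner_integral_mult_right)
  from has_bochner_integral_mono[OF this mass ineq]
  have "4 * exp (-1) \<le> (1::real)" using assms by (simp add: field_simps)
  then have "4 \<le> exp (1::real)" by (simp add: exp_minus field_simps)
  moreover have "exp (1::real) \<le> 3" by (rule exp_le)
  ultimately show False by simp
qed

text \<open>By \<open>density_drop\<close>, \<open>\<psi>\<close> rises by at least 1 over the
  distance \<open>r\<close>. Chord slopes of a convex function from \<open>w\<close> do not decrease
  farther out, so the rise at distance |t| is at least |t| / r.\<close>

lemma density_exponential_decay:
  assumes r: "r = 4 / f w" and t: "r \<le> \<bar>t\<bar>"
  shows "f (w + t) \<le> f w * exp (- \<bar>t\<bar> / r)"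
proof -
  have r0: "0 < r" using r by simp
  define s :: real where "s = sgn t"
  have s: "s = 1 \<or> s = -1" "s * \<bar>t\<bar> = t" using t r0 by (auto simp: s_def sgn_if split: if_splits)
  define u where "u = r / \<bar>t\<bar>"
  have u: "0 < u" "u \<le> 1" "u * t = s * r" using t r0 s by (auto simp: u_def field_simps)
  have "exp (- \<psi> (w + s * r)) \<le> exp (- \<psi> w + - 1)"
    using density_drop[OF r s(1)] by (simp add: exp_add[symmetric])
  then have "\<psi> w + 1 \<le> \<psi> (w + s * r)" by simp
  also have "w + s * r = (1 - u) * w + u * (w + t)" using u by (simp add: algebra_simps)
  also have "\<psi> \<dots> \<le> (1 - u) * \<psi> w + u * \<psi> (w + t)" using psi_le_segment u by simp
  finally have "1 \<le> u * (\<psi> (w + t) - \<psi> w)" by (simp add: algebra_simps)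
  then have "\<bar>t\<bar> / r \<le> \<psi> (w + t) - \<psi> w"
    using u r0 t by (simp add: u_def field_simps)
  then have "exp (- \<psi> (w + t)) \<le> exp (- \<psi> w + - \<bar>t\<bar> / r)" by simp
  then show ?thesis by (simp only: exp_add)
qed

text \<open>A large value of the density at \<open>w\<close> forces a fast decay away from \<open>w\<close>, contradicting that the
  second moment about \<open>w\<close> is at least 1.\<close>

lemma density_le: "f w \<le> 18"
proof -
  define r where "r = 4 / f w"
  have r0: "0 < r" by (simp add: r_def)
  \<comment> \<open>Near \<open>w\<close> the factor t^2 is at most (2r)^2. Farther out,
    log-concavity at the midpoint gives \<open>f (w + t) \<le> f (w + 1/2 * t) * exp (- x)\<close>
    with x = |t| / (2r), and x^2 exp (-x) \<le> 2. Majorants built from \<open>f\<close> itself have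
    integrals that follow from the mass alone.\<close>
  have ineq: "t\<^sup>2 * f (w + t) \<le> 4 * r\<^sup>2 * f (w + t) + 8 * r\<^sup>2 * f (w + 1/2 * t)" for t
  proof (cases "\<bar>t\<bar> \<le> 2 * r")
    case True
    then have "\<bar>t\<bar> \<le> \<bar>2 * r\<bar>" using r0 by simp
    then have "t\<^sup>2 \<le> (2 * r)\<^sup>2" by (simp only: abs_le_square_iff)
    then have "t\<^sup>2 * f (w + t) \<le> 4 * r\<^sup>2 * f (w + t)" by (intro mult_right_mono) (auto simp: power_mult_distrib)
    then show ?thesis by (simp add: add_increasing2)
  next
    case False
    define x where "x = \<bar>t\<bar> / (2 * r)"
    have x: "0 \<le> x" "\<bar>t\<bar> = 2 * r * x" using r0 by (auto simp: x_def)
    have t2: "t\<^sup>2 = 4 * r\<^sup>2 * x\<^sup>2" 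
      by (subst power2_abs[symmetric], subst x(2)) (simp add: power_mult_distrib)
    have "f w * f (w + t) \<le> (f (w + 1/2 * t))\<^sup>2" using density_midpoint[of w "w + t"] by (simp add: field_simps)
    also have "\<dots> \<le> f (w + 1/2 * t) * (f w * exp (- x))"
      using density_exponential_decay[OF r_def, of "1/2 * t"] False r0
      by (simp add: power2_eq_square x_def abs_mult)
    finally have a: "f (w + t) \<le> f (w + 1/2 * t) * exp (- x)" by simp
    have "x\<^sup>2 / 2 \<le> exp x" using exp_lower_Taylor_quadratic[OF x(1)] x(1) by simp
    then have b: "x\<^sup>2 * exp (- x) \<le> 2" by (simp add: exp_minus field_simps)
    have "t\<^sup>2 * f (w + t) \<le> t\<^sup>2 * (f (w + 1/2 * t) * exp (- x))" using a by (intro mult_left_mono) auto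
    also have "\<dots> = 4 * r\<^sup>2 * f (w + 1/2 * t) * (x\<^sup>2 * exp (- x))" by (simp add: t2)
    also have "\<dots> \<le> 4 * r\<^sup>2 * f (w + 1/2 * t) * 2" using b by (intro mult_left_mono) auto
    finally show ?thesis by (simp add: add_increasing)
  qed
  have m1: "has_bochner_integral lborel (\<lambda>t. f (w + t)) 1"
    using mass lborel_has_bochner_integral_real_affine_iff[of 1 f 1 w] by simp
  have m2: "has_bochner_integral lborel (\<lambda>t. f (w + 1/2 * t)) 2"
    using mass lborel_has_bochner_integral_real_affine_iff[of "1/2" f 1 w] by simp
  \<comment> \<open>Here the mean enters: the second moment about \<open>w\<close> is 1 + w^2, hence
    at least 1.\<close>
  have "has_bochner_integral lborel (\<lambda>z. z\<^sup>2 * f z - 2 * w * (z * f z) + w\<^sup>2 * f z) (1 - 2 * w * 0 + w\<^sup>2 * 1)"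
    by (intro has_bochner_integral_add has_bochner_integral_diff has_bochner_integral_mult_right mass mean second_moment)
  then have "has_bochner_integral lborel (\<lambda>z. (z - w)\<^sup>2 * f z) (1 + w\<^sup>2)"
    by (simp add: power2_eq_square algebra_simps)
  then have m3: "has_bochner_integral lborel (\<lambda>t. t\<^sup>2 * f (w + t)) (1 + w\<^sup>2)"
    using lborel_has_bochner_integral_real_affine_iff[of 1 "\<lambda>z. (z - w)\<^sup>2 * f z" "1 + w\<^sup>2" w] by simp
  have "has_bochner_integral lborel (\<lambda>t. 4 * r\<^sup>2 * f (w + t) + 8 * r\<^sup>2 * f (w + 1/2 * t)) (4 * r\<^sup>2 * 1 + 8 * r\<^sup>2 * 2)"
    by (intro has_bochner_integral_add has_bochner_integral_mult_right m1 m2)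
  from has_bochner_integral_mono[OF m3 this ineq]
  have "1 \<le> 20 * r\<^sup>2" by (simp add: add_increasing2) (smt (verit) zero_le_power2)
  then have "(f w)\<^sup>2 \<le> 320" by (simp add: r_def power_divide field_simps)
  also have "\<dots> \<le> 18\<^sup>2" by simp
  finally show ?thesis by (rule power2_le_imp_le) simp
qed

text \<open>For |w| \<le> 5 the peak bound gives 121 * 18 = 2178, which 2500 rounds up; farther out
  1 + 2|w| \<le> 3|w| and the quadratic tail give 81/4.\<close>

lemma density_weighted_le: "(1 + 2 * \<bar>w\<bar>)\<^sup>2 * f w \<le> 2500"
proof (cases "\<bar>w\<bar> \<le> 5")
  case True
  then have "(1 + 2 * \<bar>w\<bar>)\<^sup>2 \<le> 11\<^sup>2" by (intro power_mono) auto
  then have "(1 + 2 * \<bar>w\<bar>)\<^sup>2 * f w \<le> 11\<^sup>2 * 18" using density_le by (intro mult_mono) auto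
  then show ?thesis by simp
next
  case False
  then have "(1 + 2 * \<bar>w\<bar>)\<^sup>2 \<le> (3 * \<bar>w\<bar>)\<^sup>2" by (intro power_mono) auto
  then have "(1 + 2 * \<bar>w\<bar>)\<^sup>2 * f w \<le> (9 * w\<^sup>2) * (9 / (4 * w\<^sup>2))"
    using density_tail[of w] False by (intro mult_mono) (auto simp: power_mult_distrib)
  also have "\<dots> = 81 / 4" using False by simp
  finally show ?thesis by simp
qed

text \<open>Convexity between 0 and \<open>z\<close> gives sqrt (f z * f 0) \<le> f (z/2). The
  previous bound is applied at z/2, which is why its weight is 1 + 2|w|; the value
  \<open>\<psi> 0\<close> is the one in the hypothesis on \<open>M\<close>.\<close>

lemma sqrt_density_weighted_le: "(1 + \<bar>z\<bar>)\<^sup>2 * exp (- \<psi> z / 2) \<le> 2500 * exp (\<psi> 0 / 2)"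
proof -
  have "\<psi> (z / 2) \<le> (\<psi> 0 + \<psi> z) / 2" using psi_le_segment[of "1/2" 0 z] by (simp add: field_simps)
  then have "exp (- \<psi> z / 2) \<le> exp (- \<psi> (z / 2) + \<psi> 0 / 2)" by (simp add: field_simps)
  then have "(1 + \<bar>z\<bar>)\<^sup>2 * exp (- \<psi> z / 2) \<le> (1 + 2 * \<bar>z / 2\<bar>)\<^sup>2 * (f (z / 2) * exp (\<psi> 0 / 2))"
    unfolding exp_add by (intro mult_mono) auto
  also have "\<dots> \<le> 2500 * exp (\<psi> 0 / 2)"
    unfolding mult.assoc[symmetric] using density_weighted_le[of "z / 2"] by (intro mult_right_mono) auto
  finally show ?thesis .
qed

lemma density_tendsto_0: "(f \<longlongrightarrow> 0) at_infinity"
proof (rule tendsto_sandwich[of "\<lambda>_. 0"])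
  show "eventually (\<lambda>z. f z \<le> 9 / (4 * z\<^sup>2)) at_infinity"
    unfolding eventually_at_infinity using density_tail by (auto intro!: exI[of _ 5])
  have "((\<lambda>z::real. 9 / 4 * (inverse z)\<^sup>2) \<longlongrightarrow> 9 / 4 * 0\<^sup>2) at_infinity"
    by (intro tendsto_intros tendsto_inverse_0)
  then show "((\<lambda>z::real. 9 / (4 * z\<^sup>2)) \<longlongrightarrow> 0) at_infinity"
    by (simp add: field_simps)
qed auto

end

section \<open>The signed kernel and its positive part\<close>

locale scaled_target = isotropic_log_concave +
  fixes \<sigma> :: real
  assumes sigma_pos: "0 < \<sigma>"
begin

section \<open>The threshold \<open>kappa\<close> at which the slope of \<open>\<psi>\<close>
  reaches \<open>\<sigma>\<close>\<close>

lemma deriv_mono: "x \<le> y \<Longrightarrow> deriv \<psi> x \<le> deriv \<psi> y"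
proof -
  assume "x \<le> y"
  have tangent: "\<psi> v - \<psi> u \<ge> deriv \<psi> u * (v - u)" for u v
    by (rule convex_on_imp_above_tangent[OF convex]) (auto simp: DERIV_psi)
  from tangent[of x y] tangent[of y x] have "(deriv \<psi> y - deriv \<psi> x) * (x - y) \<le> 0"
    by (simp add: algebra_simps)
  with \<open>x \<le> y\<close> show ?thesis by (cases "x = y") (auto simp: mult_le_0_iff)
qed

lemma deriv_measurable [measurable]: "deriv \<psi> \<in> borel_measurable borel"
  by (rule borel_measurable_mono) (simp add: mono_def deriv_mono)

lemma psi_ge_line:
  assumes "k \<le> z" "\<And>x. k < x \<Longrightarrow> \<sigma> \<le> deriv \<psi> x"
  shows "\<psi> k + \<sigma> * (z - k) \<le> \<psi> z"
proof (cases "k = z")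
  case False
  then obtain c where "k < c" "c < z" "\<psi> z - \<psi> k = (z - k) * deriv \<psi> c"
    using MVT2[of k z \<psi> "deriv \<psi>"] DERIV_psi assms(1) by (auto simp: less_le)
  moreover have "\<sigma> * (z - k) \<le> deriv \<psi> c * (z - k)"
    using assms \<open>k < c\<close> by (intro mult_right_mono) auto
  ultimately show ?thesis unfolding mult.commute[of "z - k"] by linarith
qed simp

text \<open>A slope of at least \<open>\<sigma>\<close> everywhere would make \<open>f\<close> at
  least \<open>f 0\<close> on the whole negative axis, against its decay. Consequently the infimum
  in \<open>kappa\<close> is over a set bounded below, and the profile is positive
  somewhere.\<close>

lemma deriv_less_sigma: "\<exists>z. deriv \<psi> z < \<sigma>"
proof (rule ccontr)
  assume "\<not> ?thesis"
  then have ge: "\<sigma> \<le> deriv \<psi> z" for z by (simp add: not_less)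
  have "(f \<longlongrightarrow> 0) at_bot" using density_tendsto_0 by (simp add: at_infinity_eq_at_top_bot filterlim_def filtermap_sup)
  then have "eventually (\<lambda>z. f z < f 0) at_bot" by (rule order_tendstoD) simp
  then obtain B where B: "\<And>z. z \<le> B \<Longrightarrow> f z < f 0" by (auto simp: eventually_at_bot_linorder)
  define z where "z = min B 0"
  have "\<psi> z + \<sigma> * (0 - z) \<le> \<psi> 0" by (rule psi_ge_line) (auto simp: z_def ge)
  moreover have "0 \<le> \<sigma> * (0 - z)" using sigma_pos by (intro mult_nonneg_nonneg) (auto simp: z_def)
  ultimately have "f 0 \<le> f z" by simp
  then show False using B[of z] by (simp add: z_def)
qed

text \<open>Darboux: a minimum of \<open>\<psi> z - \<sigma> * z\<close> on [a, b] is interior,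
  since the function decreases at \<open>a\<close> and increases at \<open>b\<close>.\<close>

lemma deriv_attains_sigma:
  assumes "deriv \<psi> a < \<sigma>" "\<sigma> < deriv \<psi> b"
  shows "\<exists>z. deriv \<psi> z = \<sigma>"
proof -
  define g where "g z = \<psi> z - \<sigma> * z" for z
  have g: "DERIV g z :> deriv \<psi> z - \<sigma>" for z
    unfolding g_def by (auto intro!: derivative_eq_intros DERIV_psi)
  have ab: "a < b" using assms deriv_mono[of b a] by (meson less_trans not_less order.strict_trans2)
  have "continuous_on {a..b} g" using g DERIV_isCont continuous_at_imp_continuous_on by blast
  then obtain m where m: "m \<in> {a..b}" "\<And>y. y \<in> {a..b} \<Longrightarrow> g m \<le> g y"
    using continuous_attains_inf[of "{a..b}" g] ab by auto
  have "m \<noteq> a"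
  proof
    assume "m = a"
    from DERIV_neg_dec_right[OF g, of a] assms obtain d where d: "0 < d" "\<And>h. 0 < h \<Longrightarrow> h < d \<Longrightarrow> g (a + h) < g a" by auto
    define h where "h = min (d / 2) (b - a)"
    have "g (a + h) < g a" using d ab by (intro d) (auto simp: h_def)
    moreover have "g m \<le> g (a + h)" using d ab by (intro m) (auto simp: h_def)
    ultimately show False using \<open>m = a\<close> by simp
  qed
  moreover have "m \<noteq> b"
  proof
    assume "m = b"
    from DERIV_pos_inc_left[OF g, of b] assms obtain d where d: "0 < d" "\<And>h. 0 < h \<Longrightarrow> h < d \<Longrightarrow> g (b - h) < g b" by auto
    define h where "h = min (d / 2) (b - a)"
    have "g (b - h) < g b" using d ab by (intro d) (auto simp: h_def)
    moreover have "g m \<le> g (b - h)" using d ab by (intro m) (auto simp: h_def)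
    ultimately show False using \<open>m = b\<close> by simp
  qed
  ultimately have "a < m" "m < b" using m by auto
  then have "deriv \<psi> m - \<sigma> = 0"
    by (intro DERIV_local_min[OF g, of "min (m - a) (b - m)"]) (auto intro!: m)
  then show ?thesis by (intro exI[of _ m]) simp
qed

text \<open>Replaces the infimum by the sign information on \<open>deriv \<psi> z - \<sigma>\<close>
  that all later arguments use. An infinite \<open>kappa\<close> means that \<open>\<sigma>\<close>
  is never attained; as the slope is below \<open>\<sigma>\<close> somewhere, Darboux keeps it
  there.\<close>

lemma kappa_cases:
  obtains (real) k where "kappa \<psi> \<sigma> = ereal k" "\<And>z. z \<le> k \<Longrightarrow> deriv \<psi> z \<le> \<sigma>" "\<And>z. k < z \<Longrightarrow> \<sigma> \<le> deriv \<psi> z"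
  | (infinite) "kappa \<psi> \<sigma> = \<infinity>" "\<And>z. deriv \<psi> z \<le> \<sigma>"
proof (cases "\<exists>z. deriv \<psi> z = \<sigma>")
  case True
  define S where "S = {z. deriv \<psi> z = \<sigma>}"
  have ne: "S \<noteq> {}" using True by (simp add: S_def)
  obtain a where a: "deriv \<psi> a < \<sigma>" using deriv_less_sigma by blast
  have bdd: "bdd_below S"
  proof (rule bdd_belowI[of _ a])
    fix z assume "z \<in> S" then show "a \<le> z" using a deriv_mono[of z a] by (cases "z \<le> a") (auto simp: S_def)
  qed
  show thesis
  proof (rule real[of "Inf S"])
    show "kappa \<psi> \<sigma> = ereal (Inf S)" using True by (simp add: kappa_def S_def)
    show "deriv \<psi> z \<le> \<sigma>" if "z \<le> Inf S" for z
    proof -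
      obtain z0 where "z0 \<in> S" using ne by blast
      then have "z \<le> z0" using that bdd cInf_lower by force
      then show ?thesis using \<open>z0 \<in> S\<close> deriv_mono[of z z0] by (simp add: S_def)
    qed
    show "\<sigma> \<le> deriv \<psi> z" if less: "Inf S < z" for z
    proof -
      obtain z0 where "z0 \<in> S" "z0 < z" using cInf_lessD[OF ne less] by auto
      then show ?thesis using deriv_mono[of z0 z] by (simp add: S_def)
    qed
  qed
next
  case False
  then have "deriv \<psi> z \<le> \<sigma>" for z
    using deriv_attains_sigma deriv_less_sigma by (meson not_less)
  then show thesis using False by (intro infinite) (simp_all add: kappa_def)
qed

text \<open>Places each point with positive profile in the index set of the supremum that bounds
  \<open>M\<close>.\<close>

lemma le_kappa:
  assumes "deriv \<psi> z < \<sigma>"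
  shows "ereal z \<le> kappa \<psi> \<sigma>"
  by (cases rule: kappa_cases) (use assms in \<open>force simp: not_le[symmetric]\<close>)+

lemma tau_nonneg: "0 \<le> tau \<psi> \<sigma>"
  using sigma_pos by (auto simp: tau_def Let_def set_lebesgue_integral_def intro!: add_nonneg_nonneg integral_nonneg)

lemma tau_ge: "kappa \<psi> \<sigma> = ereal k \<Longrightarrow> f k / \<sigma> \<le> tau \<psi> \<sigma>"
proof -
  assume k: "kappa \<psi> \<sigma> = ereal k"
  have "0 \<le> (LINT z:{k..}|lborel. f z)" by (auto simp: set_lebesgue_integral_def intro!: integral_nonneg)
  moreover have "0 \<le> f k / \<sigma>" using sigma_pos by simp
  ultimately show ?thesis using k by (simp add: tau_def)
qed

section \<open>The functions s and s^+ of the overview, and the smoothing inequality for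
  them\<close>

definition profile :: "real \<Rightarrow> real" where
  "profile z = f z * (1 - deriv \<psi> z / \<sigma>)"

definition pos_profile :: "real \<Rightarrow> real" where
  "pos_profile z = max 0 (profile z)"

lemma profile_measurable [measurable]: "profile \<in> borel_measurable borel"
  unfolding profile_def by measurable

lemma pos_profile_measurable [measurable]: "pos_profile \<in> borel_measurable borel"
  unfolding pos_profile_def by measurable

lemma pos_profile_nonneg [simp]: "0 \<le> pos_profile z"
  by (simp add: pos_profile_def)

lemma profile_nonneg_iff: "0 \<le> profile z \<longleftrightarrow> deriv \<psi> z \<le> \<sigma>"
  using sigma_pos by (simp add: profile_def zero_le_mult_iff)

lemma profile_le_0: "\<sigma> \<le> deriv \<psi> z \<Longrightarrow> profile z \<le> 0"
  using sigma_pos by (simp add: profile_def mult_le_0_iff)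

lemma signed_kernel_eq: "signed_kernel \<psi> \<sigma> x y = profile ((y - x - 1) / \<sigma>) / \<sigma>"
proof -
  have "DERIV (\<lambda>\<theta>. target_density \<psi> \<sigma> y \<theta>) (x + 1) :>
      1 / \<sigma> * (f ((y - (x + 1)) / \<sigma>) * (- (deriv \<psi> ((y - (x + 1)) / \<sigma>) * (- 1 / \<sigma>))))"
    unfolding target_density_def using sigma_pos
    by (auto intro!: derivative_eq_intros DERIV_chain2[OF DERIV_psi])
  from DERIV_imp_deriv[OF this] show ?thesis
    using sigma_pos by (simp add: signed_kernel_def target_density_def profile_def field_simps)
qed

text \<open>The derivative of \<open>- exp (- e) * f (z - e / \<sigma>)\<close> in \<open>e\<close> is \<open>exp (- e) * profile (z - e / \<sigma>)\<close>:
  up to its negative part, the profile turns exponential noise into the target.\<close>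

lemma density_le_exp_smoothing_aux:
  assumes "0 \<le> e0" "\<And>e. e0 \<le> e \<Longrightarrow> deriv \<psi> (z - e / \<sigma>) \<le> \<sigma>" "f z \<le> exp (- e0) * f (z - e0 / \<sigma>)"
  shows "ennreal (f z) \<le> (\<integral>\<^sup>+e. ennreal (exp (- e) * pos_profile (z - e / \<sigma>)) * indicator {0..} e \<partial>lborel)"
proof -
  let ?F = "\<lambda>e. - (exp (- e) * f (z - e / \<sigma>))"
  have lim: "(?F \<longlongrightarrow> 0) at_top"
  proof (rule tendsto_rabs_zero_cancel, rule tendsto_sandwich[of "\<lambda>_. 0"])
    show "eventually (\<lambda>e. \<bar>?F e\<bar> \<le> 18 * exp (- e)) at_top"
      using density_le by (auto simp: abs_mult mult.commute intro!: always_eventually mult_mono)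
    have "((\<lambda>e. exp (- e)) \<longlongrightarrow> (0::real)) at_top"
      using filterlim_compose[OF exp_at_bot filterlim_uminus_at_bot_at_top] by simp
    then show "((\<lambda>e. 18 * exp (- e)) \<longlongrightarrow> (0::real)) at_top"
      by (intro tendsto_mult_right_zero)
  qed auto
  have "ennreal (f z) \<le> ennreal (0 - ?F e0)" using assms(3) by (intro ennreal_leI) simp
  also have "\<dots> = (\<integral>\<^sup>+e. ennreal (exp (- e) * profile (z - e / \<sigma>)) * indicator {e0..} e \<partial>lborel)"
  proof (rule nn_integral_FTC_atLeast[symmetric, OF _ _ _ lim])
    fix e assume e: "e0 \<le> e"
    show "0 \<le> exp (- e) * profile (z - e / \<sigma>)" using assms(2)[OF e] by (simp add: profile_nonneg_iff)
    show "DERIV ?F e :> exp (- e) * profile (z - e / \<sigma>)"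
      unfolding profile_def using sigma_pos
      by (auto intro!: derivative_eq_intros DERIV_chain2[OF DERIV_psi] simp: field_simps)
  qed measurable
  also have "\<dots> \<le> (\<integral>\<^sup>+e. ennreal (exp (- e) * pos_profile (z - e / \<sigma>)) * indicator {0..} e \<partial>lborel)"
    using assms(1) by (intro nn_integral_mono) (auto simp: pos_profile_def split: split_indicator intro!: ennreal_leI)
  finally show ?thesis .
qed

text \<open>Up to \<open>kappa\<close> the whole exponential integral has a nonnegative integrand.
  Beyond k = \<open>kappa\<close>, integration starts at e0 = \<sigma>(z - k), where z - e/\<sigma>
  has moved down to k; the boundary value exp (-e0) f k is still at least \<open>f z\<close>,
  because \<open>\<psi>\<close> lies above the line of slope \<open>\<sigma>\<close> through its
  value at k.\<close>

lemma density_le_exp_smoothing: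
  "ennreal (f z) \<le> (\<integral>\<^sup>+e. ennreal (exp (- e) * pos_profile (z - e / \<sigma>)) * indicator {0..} e \<partial>lborel)"
proof (cases rule: kappa_cases)
  case infinite
  then show ?thesis by (intro density_le_exp_smoothing_aux[of 0]) auto
next
  case (real k)
  show ?thesis
  proof (cases "z \<le> k")
    case True
    have "z - e / \<sigma> \<le> k" if "0 \<le> e" for e
      using True sigma_pos that by (smt (verit) divide_nonneg_pos)
    then show ?thesis by (intro density_le_exp_smoothing_aux[of 0]) (auto intro!: real)
  next
    case False
    show ?thesis
    proof (rule density_le_exp_smoothing_aux[of "\<sigma> * (z - k)"])
      show "0 \<le> \<sigma> * (z - k)" using sigma_pos False by simp
      show "deriv \<psi> (z - e / \<sigma>) \<le> \<sigma>" if "\<sigma> * (z - k) \<le> e" for e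
        using that sigma_pos by (intro real) (simp add: field_simps)
      have "\<psi> k + \<sigma> * (z - k) \<le> \<psi> z" using False real by (intro psi_ge_line) auto
      then have "f z \<le> exp (- (\<sigma> * (z - k)) + - \<psi> k)" by simp
      then show "f z \<le> exp (- (\<sigma> * (z - k))) * f (z - \<sigma> * (z - k) / \<sigma>)"
        using sigma_pos by (simp only: exp_add) simp
    qed
  qed
qed

lemma nn_integral_f: "(\<integral>\<^sup>+z. ennreal (f z) \<partial>lborel) = 1"
  using mass by (subst nn_integral_eq_integral) (auto simp: has_bochner_integral_iff)

section \<open>The total mass of the positive part lies between 1 and 1 + \<tau>\<close>

definition pos_mass :: ennreal where
  "pos_mass = (\<integral>\<^sup>+z. ennreal (pos_profile z) \<partial>lborel)"

lemma pos_mass_shift: "(\<integral>\<^sup>+z. ennreal (pos_profile (t + 1 * z)) \<partial>lborel) = pos_mass"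
  unfolding pos_mass_def by (subst nn_integral_real_affine[of _ 1 t]) simp_all

lemma nn_integral_exp: "(\<integral>\<^sup>+e. ennreal (exp (- e)) * indicator {0..} e \<partial>lborel) = 1"
proof -
  have "((\<lambda>e. - exp (- e)) \<longlongrightarrow> - (0::real)) at_top"
    using filterlim_compose[OF exp_at_bot filterlim_uminus_at_bot_at_top] by (intro tendsto_minus) simp
  then show ?thesis
    by (subst nn_integral_FTC_atLeast[where F = "\<lambda>e. - exp (- e)" and T = 0])
       (auto intro!: derivative_eq_intros)
qed

text \<open>Integrating the smoothing inequality over \<open>z\<close> and exchanging integrals:
  smoothing by a probability law preserves mass, and the target has mass 1.\<close>

lemma pos_mass_ge_1: "1 \<le> pos_mass"
proof -
  have "1 = (\<integral>\<^sup>+z. ennreal (f z) \<partial>lborel)" by (simp add: nn_integral_f)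
  also have "\<dots> \<le> (\<integral>\<^sup>+z. \<integral>\<^sup>+e. ennreal (exp (- e) * pos_profile (z - e / \<sigma>)) * indicator {0..} e \<partial>lborel \<partial>lborel)"
    by (intro nn_integral_mono density_le_exp_smoothing)
  also have "\<dots> = (\<integral>\<^sup>+e. \<integral>\<^sup>+z. ennreal (exp (- e) * pos_profile (z - e / \<sigma>)) * indicator {0..} e \<partial>lborel \<partial>lborel)"
    by (intro lborel_pair.Fubini') measurable
  also have "\<dots> = (\<integral>\<^sup>+e. (ennreal (exp (- e)) * indicator {0..} e) * (\<integral>\<^sup>+z. ennreal (pos_profile (- (e / \<sigma>) + 1 * z)) \<partial>lborel) \<partial>lborel)"
    by (subst nn_integral_cmult[symmetric]) (auto simp: ennreal_mult' mult_ac intro!: nn_integral_cong)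
  also have "\<dots> = (\<integral>\<^sup>+e. (ennreal (exp (- e)) * indicator {0..} e) * pos_mass \<partial>lborel)"
    by (simp only: pos_mass_shift)
  also have "\<dots> = pos_mass" by (simp add: nn_integral_multc nn_integral_exp)
  finally show ?thesis .
qed

text \<open>Left of \<open>b\<close> the profile is nonnegative and equals f + f'/\<sigma>, so over
  [b - n, b] it integrates to at most 1 + (f b - f (b - n)) / \<sigma>; monotone convergence does
  the rest. The end point is left free for the case of infinite \<open>kappa\<close>.\<close>

lemma nn_integral_pos_profile_atMost:
  assumes b: "\<And>z. z \<le> b \<Longrightarrow> deriv \<psi> z \<le> \<sigma>"
  shows "(\<integral>\<^sup>+z. ennreal (pos_profile z) * indicator {..b} z \<partial>lborel) \<le> ennreal (1 + f b / \<sigma>)"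
proof (rule LIMSEQ_le_const2)
  let ?g = "\<lambda>n z. ennreal (pos_profile z) * indicator {b - real n..b} z"
  show "(\<lambda>n. integral\<^sup>N lborel (?g n)) \<longlonglongrightarrow> (\<integral>\<^sup>+z. ennreal (pos_profile z) * indicator {..b} z \<partial>lborel)"
  proof (rule nn_integral_LIMSEQ)
    show "incseq ?g" by (auto simp: incseq_def le_fun_def split: split_indicator)
    fix z
    have "eventually (\<lambda>n. ?g n z = ennreal (pos_profile z) * indicator {..b} z) sequentially"
      using eventually_ge_at_top[of "nat \<lceil>b - z\<rceil>"]
      by eventually_elim (auto split: split_indicator simp: nat_le_iff ceiling_le_iff)
    then show "(\<lambda>n. ?g n z) \<longlonglongrightarrow> ennreal (pos_profile z) * indicator {..b} z" by (rule tendsto_eventually)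
  qed measurable
  have "integral\<^sup>N lborel (?g n) \<le> ennreal (1 + f b / \<sigma>)" for n
  proof -
    let ?a = "b - real n"
    have U: "(f has_integral 1) UNIV"
      using has_integral_integral_lborel[of f] mass by (simp add: has_bochner_integral_iff)
    then have fi: "f integrable_on {?a..b}" by (auto intro: integrable_on_subinterval)
    have J: "integral {?a..b} f \<le> 1"
      using integral_subset_le[of "{?a..b}" UNIV f] U fi by (auto simp: has_integral_iff)
    have "DERIV f z :> f z * (- deriv \<psi> z)" for z
      by (auto intro!: derivative_eq_intros DERIV_psi)
    then have "((\<lambda>z. f z * (- deriv \<psi> z)) has_integral f b - f ?a) {?a..b}"
      by (intro fundamental_theorem_of_calculus)
         (auto intro: DERIV_subset
            simp: has_real_derivative_iff_has_vector_derivative[symmetric])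
    then have "((\<lambda>z. f z + 1 / \<sigma> * (f z * (- deriv \<psi> z))) has_integral integral {?a..b} f + 1 / \<sigma> * (f b - f ?a)) {?a..b}"
      by (intro has_integral_add has_integral_mult_right integrable_integral fi)
    moreover have "(\<lambda>z. f z + 1 / \<sigma> * (f z * (- deriv \<psi> z))) = profile"
      by (auto simp: profile_def algebra_simps)
    ultimately have "integral\<^sup>N lborel (\<lambda>z. ennreal (profile z) * indicator {?a..b} z)
        = ennreal (integral {?a..b} f + 1 / \<sigma> * (f b - f ?a))"
      by (intro nn_integral_has_integral_lebesgue') (auto simp: profile_nonneg_iff b)
    also have "integral\<^sup>N lborel (\<lambda>z. ennreal (profile z) * indicator {?a..b} z) = integral\<^sup>N lborel (?g n)"
      by (intro nn_integral_cong) (auto simp: pos_profile_def max_def ennreal_neg split: split_indicator)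
    also have "ennreal (integral {?a..b} f + 1 / \<sigma> * (f b - f ?a)) \<le> ennreal (1 + f b / \<sigma>)"
      using J sigma_pos by (intro ennreal_leI) (simp add: field_simps add_increasing2)
    finally show ?thesis .
  qed
  then show "\<exists>N. \<forall>n\<ge>N. integral\<^sup>N lborel (?g n) \<le> ennreal (1 + f b / \<sigma>)" by auto
qed

text \<open>With finite \<open>kappa\<close> the positive part vanishes beyond it, and the boundary
  term is part of \<tau>. With infinite \<open>kappa\<close> the end point tends to infinity and the
  boundary term to 0, matching \<tau> = 0.\<close>

lemma pos_mass_le: "pos_mass \<le> ennreal (1 + tau \<psi> \<sigma>)"
proof (cases rule: kappa_cases)
  case (real k)
  have "pos_mass = (\<integral>\<^sup>+z. ennreal (pos_profile z) * indicator {..k} z \<partial>lborel)"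
    unfolding pos_mass_def
    using real by (intro nn_integral_cong) (auto simp: pos_profile_def not_le max_absorb1 profile_le_0 ennreal_neg split: split_indicator)
  also have "\<dots> \<le> ennreal (1 + f k / \<sigma>)" using real by (intro nn_integral_pos_profile_atMost)
  also have "\<dots> \<le> ennreal (1 + tau \<psi> \<sigma>)" using tau_ge[OF real(1)] by (intro ennreal_leI) simp
  finally show ?thesis .
next
  case infinite
  have "(f \<longlongrightarrow> 0) at_top" using density_tendsto_0 by (simp add: at_infinity_eq_at_top_bot filterlim_def filtermap_sup)
  then have "(\<lambda>n. ennreal (1 + f (real n) / \<sigma>)) \<longlonglongrightarrow> ennreal (1 + 0 / \<sigma>)"
    by (intro tendsto_intros filterlim_compose[OF _ filterlim_real_sequentially, of f]) (use sigma_pos in auto)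
  moreover have "(\<lambda>n. \<integral>\<^sup>+z. ennreal (pos_profile z) * indicator {..real n} z \<partial>lborel) \<longlonglongrightarrow> pos_mass"
    unfolding pos_mass_def
  proof (rule nn_integral_LIMSEQ)
    show "incseq (\<lambda>n z. ennreal (pos_profile z) * indicator {..real n} z)"
      by (auto simp: incseq_def le_fun_def split: split_indicator)
    fix z
    have "eventually (\<lambda>n. ennreal (pos_profile z) * indicator {..real n} z = ennreal (pos_profile z)) sequentially"
      using eventually_ge_at_top[of "nat \<lceil>z\<rceil>"]
      by eventually_elim (auto split: split_indicator simp: nat_le_iff ceiling_le_iff)
    then show "(\<lambda>n. ennreal (pos_profile z) * indicator {..real n} z) \<longlonglongrightarrow> ennreal (pos_profile z)" by (rule tendsto_eventually)
  qed measurable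
  ultimately have "pos_mass \<le> ennreal (1 + 0 / \<sigma>)"
    using infinite by (intro LIMSEQ_le[of _ _ "\<lambda>n. ennreal (1 + f (real n) / \<sigma>)"]) (auto intro!: nn_integral_pos_profile_atMost exI[of _ 0])
  then show ?thesis using infinite by (simp add: tau_def)
qed

text \<open>The envelope inequality: the right-hand side is \<open>2500 * M\<close> times the
  proposal density. Positivity of \<open>M\<close> comes from a point of slope below
  \<open>\<sigma>\<close>, where the supremum is positive.\<close>

lemma pos_profile_le:
  assumes "ereal (2 * exp (\<psi> 0 / 2)) *
      (SUP z\<in>{z. ereal z \<le> kappa \<psi> \<sigma>}. ereal (exp (- \<psi> z / 2) * (1 - deriv \<psi> z / \<sigma>))) \<le> ereal M"
  shows "0 < M" "pos_profile z \<le> 2500 * M / (2 * (1 + \<bar>z\<bar>)\<^sup>2)"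
proof -
  let ?h = "\<lambda>z. exp (- \<psi> z / 2) * (1 - deriv \<psi> z / \<sigma>)"
  have bound: "2 * exp (\<psi> 0 / 2) * ?h z \<le> M" if "deriv \<psi> z < \<sigma>" for z
  proof -
    have "ereal (2 * exp (\<psi> 0 / 2)) * ereal (?h z) \<le> ereal (2 * exp (\<psi> 0 / 2)) *
        (SUP z\<in>{z. ereal z \<le> kappa \<psi> \<sigma>}. ereal (?h z))"
      using le_kappa[OF that] by (intro ereal_mult_left_mono SUP_upper) auto
    then have "ereal (2 * exp (\<psi> 0 / 2)) * ereal (?h z) \<le> ereal M" using assms by (rule order_trans)
    then show ?thesis by simp
  qed
  have hpos: "0 < ?h z" if "deriv \<psi> z < \<sigma>" for z using that sigma_pos by simp
  obtain a where a: "deriv \<psi> a < \<sigma>" using deriv_less_sigma by blast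
  have "0 < 2 * exp (\<psi> 0 / 2) * ?h a" using hpos[OF a] by simp
  then show M: "0 < M" using bound[OF a] by linarith
  show "pos_profile z \<le> 2500 * M / (2 * (1 + \<bar>z\<bar>)\<^sup>2)"
  proof (cases "deriv \<psi> z < \<sigma>")
    case True
    \<comment> \<open>The density is split into two square roots: one stays in \<open>?h\<close>,
      which \<open>M\<close> bounds, the other absorbs the quadratic weight.\<close>
    have "profile z * (2 * (1 + \<bar>z\<bar>)\<^sup>2) = 2 * ?h z * ((1 + \<bar>z\<bar>)\<^sup>2 * exp (- \<psi> z / 2))"
      by (simp add: profile_def exp_add[symmetric])
    also have "\<dots> \<le> 2 * ?h z * (2500 * exp (\<psi> 0 / 2))"
      using hpos[OF True] by (intro mult_left_mono sqrt_density_weighted_le) auto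
    also have "\<dots> = 2500 * (2 * exp (\<psi> 0 / 2) * ?h z)" by simp
    also have "\<dots> \<le> 2500 * M" using bound[OF True] by (intro mult_left_mono) auto
    finally have "profile z \<le> 2500 * M / (2 * (1 + \<bar>z\<bar>)\<^sup>2)"
      by (intro mult_imp_le_div_pos) (auto simp: zero_less_power2)
    then show ?thesis using M by (simp add: pos_profile_def)
  next
    case False
    then show ?thesis using M profile_le_0[of z] by (simp add: pos_profile_def)
  qed
qed

end

section \<open>Measurability of the machine semantics\<close>

lemma space_star_borel [simp]: "space star_borel = UNIV"
  by (simp add: star_borel_def space_measure_of_conv)

text \<open>Preimages commute with complements and unions, so the generating family is already a
  sigma-algebra.\<close>

lemma sets_star_borel: "sets star_borel = {A. Some -` A \<in> sets borel}"
proof -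
  have "sigma_algebra (UNIV :: real option set) {A. Some -` A \<in> sets borel}"
    unfolding sigma_algebra_iff2
  proof (intro conjI ballI allI impI)
    fix A :: "real option set" assume "A \<in> {A. Some -` A \<in> sets borel}"
    then have "- (Some -` A) \<in> sets borel" by (simp add: borel_comp)
    then show "UNIV - A \<in> {A. Some -` A \<in> sets borel}" by (simp add: vimage_Compl Compl_eq_Diff_UNIV[symmetric])
  next
    fix A :: "nat \<Rightarrow> real option set" assume "range A \<subseteq> {A. Some -` A \<in> sets borel}"
    then have "(\<Union>i. Some -` A i) \<in> sets borel" by (intro sets.countable_UN) auto
    then show "\<Union> (range A) \<in> {A. Some -` A \<in> sets borel}" by (simp add: vimage_UN)
  qed auto
  then show ?thesis
    by (simp add: star_borel_def sigma_algebra.sigma_sets_eq)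
qed

lemma measurable_Some [measurable]: "Some \<in> borel \<rightarrow>\<^sub>M star_borel"
  by (rule measurableI) (auto simp: sets_star_borel)

text \<open>The default 0 agrees with the semantics of \<open>Load\<close>.\<close>

definition entry_value :: "real option \<Rightarrow> real" where
  "entry_value e = (case e of None \<Rightarrow> 0 | Some v \<Rightarrow> v)"

lemma entry_value_measurable [measurable]: "entry_value \<in> star_borel \<rightarrow>\<^sub>M borel"
proof (rule measurableI)
  fix A :: "real set" assume "A \<in> sets borel"
  moreover have "Some -` entry_value -` A = A" by (auto simp: entry_value_def)
  ultimately show "entry_value -` A \<inter> space star_borel \<in> sets star_borel"
    by (simp add: sets_star_borel)
qed simp

lemma space_obs_space: "space (obs_space n) = PiE {1..n} (\<lambda>_. UNIV)"
  by (simp add: obs_space_def space_PiM)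

lemma entry_measurable [measurable]: "i \<in> {1..n} \<Longrightarrow> (\<lambda>w. w i) \<in> obs_space n \<rightarrow>\<^sub>M star_borel"
  unfolding obs_space_def by measurable

lemma store_measurable:
  assumes "i \<in> {1..n}" "w \<in> N \<rightarrow>\<^sub>M obs_space n" "v \<in> N \<rightarrow>\<^sub>M borel"
  shows "(\<lambda>x. (w x)(i := Some (v x))) \<in> N \<rightarrow>\<^sub>M obs_space n"
  unfolding obs_space_def
  by (rule measurable_fun_upd[where J = "{1..n}"]) (use assms in \<open>auto simp: obs_space_def\<close>)

lemma store_in_space: "i \<in> {1..n} \<Longrightarrow> w \<in> space (obs_space n) \<Longrightarrow> w(i := v) \<in> space (obs_space n)"
  by (auto simp: space_obs_space PiE_def extensional_def)

lemma space_state_space [simp]: "(R, w) \<in> space (state_space n) \<longleftrightarrow> w \<in> space (obs_space n)"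
  by (simp add: state_space_def space_pair_measure space_PiM)

lemma register_measurable [measurable]: "(\<lambda>s. fst s r) \<in> state_space n \<rightarrow>\<^sub>M borel"
  unfolding state_space_def by measurable

lemma vector_measurable [measurable]: "snd \<in> state_space n \<rightarrow>\<^sub>M obs_space n"
  unfolding state_space_def by measurable

lemma set_register_measurable:
  assumes [measurable]: "s \<in> N \<rightarrow>\<^sub>M state_space n" "v \<in> N \<rightarrow>\<^sub>M borel"
  shows "(\<lambda>x. ((fst (s x))(r := v x), snd (s x))) \<in> N \<rightarrow>\<^sub>M state_space n"
proof -
  have "(\<lambda>x. (fst (s x))(r := v x)) \<in> N \<rightarrow>\<^sub>M (\<Pi>\<^sub>M r\<in>UNIV. borel)"
    by (rule measurable_fun_upd[where J = UNIV])
       (auto intro!: measurable_compose[OF assms(1)] simp: state_space_def)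
  then show ?thesis unfolding state_space_def[of n]
    by (intro measurable_Pair measurable_compose[OF assms(1)]) (simp_all add: vector_measurable)
qed

lemma arith_measurable:
  "u \<in> N \<rightarrow>\<^sub>M borel \<Longrightarrow> v \<in> N \<rightarrow>\<^sub>M borel \<Longrightarrow> (\<lambda>x. arith g (u x) (v x)) \<in> N \<rightarrow>\<^sub>M borel"
  by (cases g) simp_all

context scaled_target
begin

lemma distr_affine_density:
  assumes "0 < c"
  shows "distr (density lborel (\<lambda>z. ennreal (f z))) borel (\<lambda>z. t + c * z)
    = density lborel (\<lambda>y. ennreal (1 / c * f ((y - t) / c)))"
proof (rule measure_eqI)
  fix A assume "A \<in> sets (distr (density lborel (\<lambda>z. ennreal (f z))) borel (\<lambda>z. t + c * z))"
  then have [measurable]: "A \<in> sets borel" by simp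
  have [measurable]: "(\<lambda>z. t + c * z) -` A \<in> sets borel"
    using measurable_sets_borel[of "\<lambda>z. t + c * z" borel A] by simp
  have "emeasure (density lborel (\<lambda>y. ennreal (1 / c * f ((y - t) / c)))) A
      = (\<integral>\<^sup>+y. ennreal (1 / c * f ((y - t) / c)) * indicator A y \<partial>lborel)"
    by (subst emeasure_density) auto
  also have "\<dots> = c * (\<integral>\<^sup>+z. ennreal (1 / c * f z) * indicator A (t + c * z) \<partial>lborel)"
    using assms by (subst nn_integral_real_affine[where c = c and t = t]) auto
  also have "\<dots> = (\<integral>\<^sup>+z. ennreal (f z) * indicator A (t + c * z) \<partial>lborel)"
    using assms by (subst nn_integral_cmult[symmetric]) (auto simp: ennreal_mult'[symmetric] mult.assoc[symmetric])
  also have "\<dots> = emeasure (distr (density lborel (\<lambda>z. ennreal (f z))) borel (\<lambda>z. t + c * z)) A"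
    by (subst emeasure_distr) (auto simp: emeasure_density intro!: nn_integral_cong split: split_indicator)
  finally show "emeasure (distr (density lborel (\<lambda>z. ennreal (f z))) borel (\<lambda>z. t + c * z)) A
    = emeasure (density lborel (\<lambda>y. ennreal (1 / c * f ((y - t) / c)))) A" ..
qed simp

lemma prob_space_density: "prob_space (density lborel (\<lambda>z. ennreal (f z)))"
  by (rule prob_spaceI) (simp add: emeasure_density nn_integral_f)

text \<open>As an affine image of a fixed law, the sampling measure depends on \<open>x\<close> only
  through the map; measurability of \<open>Sample\<close> in the state then follows from joint
  measurability of that map.\<close>

lemma base_measure_eq:
  "base_measure \<psi> \<sigma> x = distr (density lborel (\<lambda>z. ennreal (f z))) borel (\<lambda>z. (x + 1) + 2 * \<sigma> * z)"
  using sigma_pos by (subst distr_affine_density) (auto simp: base_measure_def algebra_simps)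

lemma prob_space_uniform: "prob_space (uniform_measure lborel {0..1::real})"
  by (rule prob_space_uniform_measure) auto

lemma measurable_Repeat:
  assumes [measurable]: "\<kappa> \<in> M \<rightarrow>\<^sub>M prob_algebra M"
  shows "(\<lambda>s. ((\<lambda>m. m \<bind> \<kappa>) ^^ k) (return M s)) \<in> M \<rightarrow>\<^sub>M prob_algebra M"
  by (induction k) (auto intro: measurable_bind_prob_space assms)

lemma signed_kernel_measurable [measurable]:
  "(\<lambda>(x, y). signed_kernel \<psi> \<sigma> x y) \<in> borel \<Otimes>\<^sub>M borel \<rightarrow>\<^sub>M borel"
  unfolding signed_kernel_eq by measurable

text \<open>Makes every program a Markov kernel, which the claim on \<open>h\<close> requires and
  which allows integrals along \<open>Seq\<close> to be iterated.\<close>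

theorem measurable_sem: "sem \<psi> \<sigma> n c \<in> state_space n \<rightarrow>\<^sub>M prob_algebra (state_space n)"
proof (induction c)
  case (Load r i)
  have "(\<lambda>s. if i \<in> {1..n} then entry_value (snd s i) else 0) \<in> state_space n \<rightarrow>\<^sub>M borel"
    by (cases "i \<in> {1..n}") (auto intro!: measurable_compose[OF vector_measurable] measurable_compose[OF entry_measurable entry_value_measurable])
  then show ?case unfolding entry_value_def sem.simps case_prod_unfold
    by (auto intro!: measurable_compose[OF _ measurable_return_prob_space] set_register_measurable)
next
  case (Store i r)
  show ?case
  proof (cases "i \<in> {1..n}")
    case True
    then have "(\<lambda>s. (fst s, (snd s)(i := Some (fst s r)))) \<in> state_space n \<rightarrow>\<^sub>M state_space n"
      unfolding state_space_def[of n]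
      by (intro measurable_Pair store_measurable) auto
    then show ?thesis using True
      by (auto simp: case_prod_unfold intro!: measurable_compose[OF _ measurable_return_prob_space])
  qed (auto simp: case_prod_unfold)
next
  case (Uniform r)
  show ?case unfolding sem.simps case_prod_unfold
    by (rule measurable_distr_prob_space2[where M = borel])
       (auto simp: space_prob_algebra prob_space_uniform case_prod_unfold intro!: measurable_const set_register_measurable)
next
  case (Sample r x)
  have "distr (base_measure \<psi> \<sigma> (fst s x)) (state_space n) (\<lambda>v. ((fst s)(r := v), snd s))
     = distr (density lborel (\<lambda>z. ennreal (f z))) (state_space n) (\<lambda>z. ((fst s)(r := (fst s x + 1) + 2 * \<sigma> * z), snd s))"
    if "s \<in> space (state_space n)" for s
    unfolding base_measure_eq
    by (subst distr_distr) (use that in \<open>auto simp: comp_def intro!: set_register_measurable measurable_const\<close>)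
  moreover have "(\<lambda>s. distr (density lborel (\<lambda>z. ennreal (f z))) (state_space n)
      (\<lambda>z. ((fst s)(r := (fst s x + 1) + 2 * \<sigma> * z), snd s))) \<in> state_space n \<rightarrow>\<^sub>M prob_algebra (state_space n)"
    by (rule measurable_distr_prob_space2[where M = borel])
       (auto simp: space_prob_algebra prob_space_density case_prod_unfold
        intro!: measurable_const set_register_measurable borel_measurable_add borel_measurable_times
          measurable_compose[OF measurable_fst register_measurable])
  ultimately show ?case
    by (auto simp: case_prod_unfold cong: measurable_cong)
next
  case (Seq c d)
  then show ?case by (simp add: measurable_bind_prob_space)
next
  case (IfLe a b c d)
  then show ?case unfolding sem.simps by (intro measurable_If) auto
next
  case (Repeat k c)
  then show ?case by (simp add: measurable_Repeat)
qed (auto simp: case_prod_unfold intro!: measurable_compose[OF _ measurable_return_prob_space] set_register_measurable arith_measurable,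
     (auto simp: case_prod_unfold)?)

end

section \<open>One round of rejection sampling\<close>

definition block :: "cmd list \<Rightarrow> cmd" where
  "block cs = foldr Seq cs Skip"

text \<open>One round of rejection sampling: register 0 holds \<open>x\<close>, register 1 the last accepted
  value. The proposal \<open>z = t / (1 - \<bar>t\<bar>)\<close>, with \<open>t\<close> uniform on \<open>[-1, 1]\<close>, has density
  \<open>(1 - \<bar>t\<bar>)\<^sup>2 / 2 = 1 / (2 * (1 + \<bar>z\<bar>)\<^sup>2)\<close>, which elementary operations can evaluate.\<close>

definition trial :: "real \<Rightarrow> real \<Rightarrow> cmd" where
  "trial \<sigma> b = block
    [Uniform 2, Uniform 3,
     Const 4 2, Arith 2 Mul 2 4, Const 4 1, Arith 2 Sub 2 4,
     Const 5 0, IfLe 5 2 (Arith 5 Sub 4 2) (Arith 5 Add 4 2),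
     Arith 2 Div 2 5,
     Const 6 \<sigma>, Arith 2 Mul 2 6, Arith 2 Add 2 4, Arith 2 Add 2 0,
     Eval 7 0 2,
     Const 6 b, Arith 6 Mul 6 5, Arith 6 Mul 6 5, Arith 6 Mul 6 3,
     Const 8 0, IfLe 6 7 (Arith 1 Add 2 8) Skip]"

text \<open>Register 1 is not reset: if all \<open>k\<close> trials fail, the stored value is
  whatever an earlier entry left there, or the initial 0. The lower bounds below hold for any
  content of the registers.\<close>

definition entry :: "real \<Rightarrow> real \<Rightarrow> nat \<Rightarrow> nat \<Rightarrow> cmd" where
  "entry \<sigma> b k i = block [Load 0 i, Repeat k (trial \<sigma> b), Store i 1]"

section \<open>The heavy-tailed proposal by inverse transform sampling\<close>

definition proposal :: "real \<Rightarrow> real" where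
  "proposal u = (2 * u - 1) / (1 - \<bar>2 * u - 1\<bar>)"

definition proposal_density :: "real \<Rightarrow> real" where
  "proposal_density z = 1 / (2 * (1 + \<bar>z\<bar>)\<^sup>2)"

lemma proposal_measurable [measurable]: "proposal \<in> borel \<rightarrow>\<^sub>M borel"
  unfolding proposal_def by measurable

lemma proposal_density_measurable [measurable]: "proposal_density \<in> borel \<rightarrow>\<^sub>M borel"
  unfolding proposal_density_def by measurable

lemma proposal_density_pos: "0 < proposal_density z"
  by (simp add: proposal_density_def add_pos_nonneg)

text \<open>This function inverts t / (1 - |t|), so half of its derivative is the density of the
  proposal. Its smoothness at 0, despite the absolute value, is read off the difference quotient 1 /
  (1 + |h|).\<close>

lemma DERIV_softsign: "DERIV (\<lambda>z::real. z / (1 + \<bar>z\<bar>)) z :> 1 / (1 + \<bar>z\<bar>)\<^sup>2"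
proof (cases "z = 0")
  case True
  have "((\<lambda>h::real. 1 / (1 + \<bar>h\<bar>)) \<longlongrightarrow> 1 / (1 + \<bar>0\<bar>)) (at 0)"
    by (intro tendsto_intros) auto
  moreover have "eventually (\<lambda>h::real. 1 / (1 + \<bar>h\<bar>) = h / (1 + \<bar>h\<bar>) / h) (at 0)"
    by (auto simp: eventually_at intro!: exI[of _ 1])
  ultimately have "((\<lambda>h::real. h / (1 + \<bar>h\<bar>) / h) \<longlongrightarrow> 1) (at 0)"
    by (subst tendsto_cong[symmetric]) auto
  then show ?thesis using True by (simp add: DERIV_def)
next
  case False
  have "DERIV abs z :> sgn z"
  proof (rule has_field_derivative_transform_within)
    show "DERIV (\<lambda>x. sgn z * x) z :> sgn z" by (auto intro!: derivative_eq_intros)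
    show "0 < \<bar>z\<bar>" using False by simp
    show "sgn z * x = \<bar>x\<bar>" if "dist x z < \<bar>z\<bar>" for x
      using that by (auto simp: dist_real_def sgn_if abs_if split: if_splits)
  qed simp
  moreover have "1 + \<bar>z\<bar> \<noteq> 0" "\<bar>z\<bar> = z * sgn z" by (auto simp: abs_real_def sgn_if)
  ultimately show ?thesis
    by (auto intro!: derivative_eq_intros simp: power2_eq_square divide_simps)
qed

lemma nn_integral_proposal_density_Ici:
  "(\<integral>\<^sup>+z. ennreal (proposal_density z) * indicator {s..} z \<partial>lborel) = ennreal ((1 - s / (1 + \<bar>s\<bar>)) / 2)"
proof -
  have "((\<lambda>z::real. z / (1 + \<bar>z\<bar>)) \<longlongrightarrow> 1) at_top"
  proof (rule Lim_transform_eventually)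
    have "((\<lambda>z::real. 1 - inverse (1 + z)) \<longlongrightarrow> 1 - 0) at_top"
      by (intro tendsto_intros tendsto_inverse_0_at_top filterlim_tendsto_add_at_top[OF tendsto_const] filterlim_ident)
    then show "((\<lambda>z::real. 1 - inverse (1 + z)) \<longlongrightarrow> 1) at_top" by simp
    show "eventually (\<lambda>z::real. 1 - inverse (1 + z) = z / (1 + \<bar>z\<bar>)) at_top"
      using eventually_ge_at_top[of 0] by eventually_elim (auto simp: field_simps)
  qed
  then have lim: "((\<lambda>z::real. z / (1 + \<bar>z\<bar>) / 2) \<longlongrightarrow> 1 / 2) at_top" by (intro tendsto_intros) auto
  have "(\<integral>\<^sup>+z. ennreal (proposal_density z) * indicator {s..} z \<partial>lborel) = ennreal (1 / 2 - s / (1 + \<bar>s\<bar>) / 2)"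
  proof (rule nn_integral_FTC_atLeast[OF _ _ _ lim])
    show "DERIV (\<lambda>z. z / (1 + \<bar>z\<bar>) / 2) z :> proposal_density z" for z
      by (rule DERIV_cong[OF DERIV_cdivide[OF DERIV_softsign]]) (simp add: proposal_density_def)
  qed (auto simp: proposal_density_def)
  then show ?thesis by (simp add: diff_divide_distrib)
qed

text \<open>Exceeding \<open>s\<close> is an interval event for the uniform variable, which yields
  the tail probabilities of the proposal.\<close>

lemma proposal_gt_iff:
  assumes "0 < u" "u < 1"
  shows "s < proposal u \<longleftrightarrow> (1 + s / (1 + \<bar>s\<bar>)) / 2 < u"
proof -
  define t where "t = 2 * u - 1"
  have t: "\<bar>t\<bar> < 1" using assms by (auto simp: t_def)
  have "s < t / (1 - \<bar>t\<bar>) \<longleftrightarrow> s * (1 - \<bar>t\<bar>) < t" using t by (simp add: pos_less_divide_eq)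
  also have "\<dots> \<longleftrightarrow> s < t * (1 + \<bar>s\<bar>)"
  proof (cases "0 \<le> s"; cases "0 \<le> t")
    assume "0 \<le> s" "\<not> 0 \<le> t"
    then have "0 \<le> s * (1 - \<bar>t\<bar>)" "t * (1 + \<bar>s\<bar>) \<le> 0" using t by (auto simp: mult_le_0_iff)
    then show ?thesis using \<open>0 \<le> s\<close> \<open>\<not> 0 \<le> t\<close> by linarith
  next
    assume "\<not> 0 \<le> s" "0 \<le> t"
    then have "s * (1 - \<bar>t\<bar>) < 0" "0 \<le> t * (1 + \<bar>s\<bar>)" using t by (auto simp: mult_less_0_iff)
    then show ?thesis using \<open>\<not> 0 \<le> s\<close> \<open>0 \<le> t\<close> by linarith
  qed (auto simp: algebra_simps)
  also have "\<dots> \<longleftrightarrow> s / (1 + \<bar>s\<bar>) < t" by (simp add: pos_divide_less_eq)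
  finally show ?thesis by (auto simp: proposal_def t_def)
qed

text \<open>The end points are discarded because the proposal formula divides by 0 there.\<close>

lemma nn_integral_uniform:
  assumes "g \<in> borel_measurable borel"
  shows "(\<integral>\<^sup>+u. g u \<partial>uniform_measure lborel {0..1::real}) = (\<integral>\<^sup>+u. g u * indicator {0<..<1} u \<partial>lborel)"
proof -
  have "(\<integral>\<^sup>+u. g u \<partial>uniform_measure lborel {0..1::real}) = (\<integral>\<^sup>+u. g u * indicator {0..1} u \<partial>lborel)"
    using assms by (subst nn_integral_uniform_measure) (auto simp: divide_ennreal_def)
  also have "\<dots> = (\<integral>\<^sup>+u. g u * indicator {0<..<1} u \<partial>lborel)"
  proof (rule nn_integral_cong_AE)
    have "AE u in lborel. u \<noteq> (0::real)" "AE u in lborel. u \<noteq> (1::real)" by (auto intro: AE_lborel_singleton)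
    then show "AE u in lborel. g u * indicator {0..1} u = g u * indicator {0<..<1} u"
      by eventually_elim (auto split: split_indicator)
  qed
  finally show ?thesis .
qed

text \<open>Both laws give the half-line beyond \<open>s\<close> the mass (1 - s / (1 + |s|)) / 2,
  and such half-lines determine a measure.\<close>

lemma distr_proposal:
  "distr (uniform_measure lborel {0..1}) borel proposal = density lborel (\<lambda>z. ennreal (proposal_density z))"
proof (rule measure_eqI_lessThan)
  fix s :: real
  define c where "c = (1 + s / (1 + \<bar>s\<bar>)) / 2"
  have s: "-1 < s / (1 + \<bar>s\<bar>)" "s / (1 + \<bar>s\<bar>) < 1" by (auto simp: pos_divide_less_eq pos_less_divide_eq)
  then have c: "0 < c" "c < 1" by (auto simp: c_def)
  have "emeasure (distr (uniform_measure lborel {0..1}) borel proposal) {s<..}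
      = (\<integral>\<^sup>+u. indicator {s<..} (proposal u) \<partial>uniform_measure lborel {0..1::real})"
    by (subst nn_integral_indicator[symmetric], simp, subst nn_integral_distr) auto
  also have "\<dots> = (\<integral>\<^sup>+u. indicator {c<..<1} u \<partial>lborel)"
    by (subst nn_integral_uniform)
       (use c in \<open>auto simp: proposal_gt_iff c_def[symmetric] split: split_indicator
          simp del: nn_integral_indicator intro!: nn_integral_cong\<close>)
  also have "\<dots> = ennreal (1 - c)" using c by simp
  also have "1 - c = (1 - s / (1 + \<bar>s\<bar>)) / 2" by (simp add: c_def field_simps)
  finally have L: "emeasure (distr (uniform_measure lborel {0..1}) borel proposal) {s<..} = ennreal ((1 - s / (1 + \<bar>s\<bar>)) / 2)" .
  have "emeasure (density lborel (\<lambda>z. ennreal (proposal_density z))) {s<..}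
      = (\<integral>\<^sup>+z. ennreal (proposal_density z) * indicator {s<..} z \<partial>lborel)"
    by (subst emeasure_density) auto
  also have "\<dots> = (\<integral>\<^sup>+z. ennreal (proposal_density z) * indicator {s..} z \<partial>lborel)"
    by (intro nn_integral_cong_AE, use AE_lborel_singleton[of s] in eventually_elim) (auto split: split_indicator)
  also have "\<dots> = ennreal ((1 - s / (1 + \<bar>s\<bar>)) / 2)" by (rule nn_integral_proposal_density_Ici)
  finally show "emeasure (distr (uniform_measure lborel {0..1}) borel proposal) {s<..}
      = emeasure (density lborel (\<lambda>z. ennreal (proposal_density z))) {s<..}" using L by simp
  show "emeasure (distr (uniform_measure lborel {0..1}) borel proposal) {s<..} < \<infinity>" using L by simp
qed auto

lemma one_minus_abs_eq:
  assumes "0 < u" "u < 1"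
  shows "1 - \<bar>2 * u - 1\<bar> = 1 / (1 + \<bar>proposal u\<bar>)"
proof -
  define t where "t = 2 * u - 1"
  have t: "\<bar>t\<bar> < 1" using assms by (auto simp: t_def)
  then have "\<bar>proposal u\<bar> = \<bar>t\<bar> / (1 - \<bar>t\<bar>)" by (simp add: proposal_def t_def abs_divide)
  moreover have "1 + \<bar>t\<bar> / (1 - \<bar>t\<bar>) = 1 / (1 - \<bar>t\<bar>)" using t by (simp add: field_simps)
  ultimately show ?thesis by (simp add: t_def)
qed

text \<open>The acceptance coin. A negative \<open>d\<close> gives probability 0, which is how the
  test cuts the signed kernel down to its positive part.\<close>

lemma nn_integral_uniform_accept:
  assumes "0 < c" "d \<le> c"
  shows "(\<integral>\<^sup>+v. (if c * v \<le> d then P else Q) \<partial>uniform_measure lborel {0..1::real})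
    = ennreal (max 0 (d / c)) * P + ennreal (1 - max 0 (d / c)) * Q"
proof -
  define r where "r = max 0 (d / c)"
  have r: "0 \<le> r" "r \<le> 1" using assms by (auto simp: r_def)
  have "(\<integral>\<^sup>+v. (if c * v \<le> d then P else Q) \<partial>uniform_measure lborel {0..1::real})
      = (\<integral>\<^sup>+v. (if c * v \<le> d then P else Q) * indicator {0<..<1} v \<partial>lborel)"
    by (rule nn_integral_uniform) measurable
  also have "\<dots> = (\<integral>\<^sup>+v. P * indicator {0..r} v + Q * indicator {r..1} v \<partial>lborel)"
  proof (rule nn_integral_cong_AE)
    have "AE v in lborel. v \<noteq> (0::real)" "AE v in lborel. v \<noteq> (1::real)" "AE v in lborel. v \<noteq> r"
      by (auto intro: AE_lborel_singleton)
    then show "AE v in lborel. (if c * v \<le> d then P else Q) * indicator {0<..<1} v = P * indicator {0..r} v + Q * indicator {r..1} v"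
    proof eventually_elim
      case (elim v)
      have "c * v \<le> d \<longleftrightarrow> v \<le> r" if "0 < v"
        using that assms by (auto simp: r_def pos_le_divide_eq mult.commute le_max_iff_disj)
      then show ?case using elim r by (auto split: split_indicator)
    qed
  qed
  also have "\<dots> = ennreal r * P + ennreal (1 - r) * Q"
    using r by (simp add: nn_integral_add nn_integral_cmult mult.commute)
  finally show ?thesis by (simp add: r_def)
qed

lemma block_Nil [simp]: "block [] = Skip"
  and block_Cons: "block (c # cs) = Seq c (block cs)"
  by (simp_all add: block_def)

context scaled_target
begin

section \<open>Integrals of test functions along program runs\<close>

lemma sets_sem: "s \<in> space (state_space n) \<Longrightarrow> sets (sem \<psi> \<sigma> n c s) = sets (state_space n)"
  by (rule sets_kernel[OF measurable_prob_algebraD[OF measurable_sem]])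

lemma nn_integral_sem_measurable [measurable]:
  "F \<in> borel_measurable (state_space n) \<Longrightarrow>
    (\<lambda>s. \<integral>\<^sup>+t. F t \<partial>sem \<psi> \<sigma> n c s) \<in> borel_measurable (state_space n)"
  by (rule nn_integral_measurable_subprob_algebra2[where N = "state_space n"])
     (auto simp: case_prod_unfold intro: measurable_prob_algebraD measurable_sem)

lemma nn_integral_Seq:
  assumes "F \<in> borel_measurable (state_space n)" "s \<in> space (state_space n)"
  shows "(\<integral>\<^sup>+t. F t \<partial>sem \<psi> \<sigma> n (Seq c d) s) = (\<integral>\<^sup>+t. \<integral>\<^sup>+t'. F t' \<partial>sem \<psi> \<sigma> n d t \<partial>sem \<psi> \<sigma> n c s)"
proof -
  have "sem \<psi> \<sigma> n d \<in> sem \<psi> \<sigma> n c s \<rightarrow>\<^sub>M subprob_algebra (state_space n)"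
    using measurable_prob_algebraD[OF measurable_sem] sets_sem[OF assms(2)] by (simp cong: measurable_cong_sets)
  with assms(1) show ?thesis by (simp add: nn_integral_bind)
qed

text \<open>Rewrite rules that execute deterministic instructions symbolically; a conditional moves
  its chosen branch to the head of the block.\<close>

lemma sem_block:
  assumes "w \<in> space (obs_space n)"
  shows "sem \<psi> \<sigma> n (block (Const r v # cs)) (R, w) = sem \<psi> \<sigma> n (block cs) (R(r := v), w)"
    and "sem \<psi> \<sigma> n (block (Arith r g a b # cs)) (R, w) = sem \<psi> \<sigma> n (block cs) (R(r := arith g (R a) (R b)), w)"
    and "sem \<psi> \<sigma> n (block (Eval r a b # cs)) (R, w) = sem \<psi> \<sigma> n (block cs) (R(r := signed_kernel \<psi> \<sigma> (R a) (R b)), w)"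
    and "sem \<psi> \<sigma> n (block (Skip # cs)) (R, w) = sem \<psi> \<sigma> n (block cs) (R, w)"
    and "sem \<psi> \<sigma> n (block (IfLe a b c d # cs)) (R, w) =
      (if R a \<le> R b then sem \<psi> \<sigma> n (block (c # cs)) (R, w) else sem \<psi> \<sigma> n (block (d # cs)) (R, w))"
    and "i \<in> {1..n} \<Longrightarrow> sem \<psi> \<sigma> n (block (Load r i # cs)) (R, w) = sem \<psi> \<sigma> n (block cs) (R(r := entry_value (w i)), w)"
    and "i \<in> {1..n} \<Longrightarrow> sem \<psi> \<sigma> n (block (Store i r # cs)) (R, w) = sem \<psi> \<sigma> n (block cs) (R, w(i := Some (R r)))"
  unfolding block_Cons using assms
  by (simp_all add: bind_return[OF measurable_prob_algebraD[OF measurable_sem]] store_in_space entry_value_def)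

lemma nn_integral_block_Uniform:
  assumes "F \<in> borel_measurable (state_space n)" "w \<in> space (obs_space n)"
  shows "(\<integral>\<^sup>+t. F t \<partial>sem \<psi> \<sigma> n (block (Uniform r # cs)) (R, w))
    = (\<integral>\<^sup>+u. \<integral>\<^sup>+t. F t \<partial>sem \<psi> \<sigma> n (block cs) (R(r := u), w) \<partial>uniform_measure lborel {0..1})"
proof -
  have "(\<lambda>u. (R(r := u), w)) \<in> borel \<rightarrow>\<^sub>M state_space n"
    using set_register_measurable[of "\<lambda>_. (R, w)" borel n "\<lambda>u. u" r] assms by simp
  then have "(\<lambda>u. (R(r := u), w)) \<in> uniform_measure lborel {0..1} \<rightarrow>\<^sub>M state_space n"
    by (simp cong: measurable_cong_sets)
  with assms show ?thesis
    unfolding block_Cons by (subst nn_integral_Seq) (auto simp: nn_integral_distr)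
qed

text \<open>The test function sees registers 0 and 1 and the vector; the other registers are
  scratch. The two uniform draws become the outer integrals and the remaining instructions are
  executed symbolically. Register 8 holds 0, so adding it copies the accepted value.\<close>

lemma nn_integral_trial_aux:
  assumes [measurable]: "(\<lambda>s. \<phi> (fst s 0) (fst s 1) (snd s)) \<in> borel_measurable (state_space n)"
    and w: "w \<in> space (obs_space n)"
  shows "(\<integral>\<^sup>+s. \<phi> (fst s 0) (fst s 1) (snd s) \<partial>sem \<psi> \<sigma> n (trial \<sigma> b) (R, w))
    = (\<integral>\<^sup>+u. \<integral>\<^sup>+v. (if b * (1 - \<bar>2 * u - 1\<bar>)\<^sup>2 * v \<le> profile (proposal u) / \<sigma>
          then \<phi> (R 0) (proposal u * \<sigma> + 1 + R 0) w else \<phi> (R 0) (R 1) w)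
        \<partial>uniform_measure lborel {0..1} \<partial>uniform_measure lborel {0..1})"
proof -
  have return: "(\<integral>\<^sup>+s. \<phi> (fst s 0) (fst s (Suc 0)) (snd s) \<partial>return (state_space n) (R', w)) = \<phi> (R' 0) (R' (Suc 0)) w" for R'
    using w by (subst nn_integral_return) (use assms(1) in auto)
  show ?thesis
    unfolding trial_def
  proof (subst nn_integral_block_Uniform[OF _ w], measurable, subst nn_integral_block_Uniform[OF _ w], measurable,
      intro nn_integral_cong, goal_cases)
    case (1 u v)
    \<comment> \<open>The program computes the absolute value by branching on the sign.\<close>
    consider "0 \<le> 2 * u - 1" "\<bar>2 * u - 1\<bar> = 2 * u - 1" | "\<not> 0 \<le> 2 * u - 1" "\<bar>2 * u - 1\<bar> = - (2 * u - 1)" by linarith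
    then show ?case
      by cases (use sigma_pos in \<open>simp_all add: sem_block[OF w] return signed_kernel_eq proposal_def power2_eq_square mult_ac\<close>)
  qed
qed
end

lemma AE_uniform_open: "AE u in uniform_measure lborel {0..1::real}. 0 < u \<and> u < 1"
proof -
  have "AE u in lborel. u \<noteq> (0::real)" "AE u in lborel. u \<noteq> (1::real)" by (auto intro: AE_lborel_singleton)
  then have "AE u in lborel. u \<in> {0..1} \<longrightarrow> 0 < u \<and> u < (1::real)" by eventually_elim auto
  then show ?thesis using AE_uniform_measure[of lborel "{0..1::real}" "\<lambda>u. 0 < u \<and> u < 1"] by simp
qed

lemma nn_integral_uniform_proposal:
  assumes [measurable]: "g \<in> borel_measurable borel"
  shows "(\<integral>\<^sup>+u. g (proposal u) \<partial>uniform_measure lborel {0..1}) = (\<integral>\<^sup>+z. ennreal (proposal_density z) * g z \<partial>lborel)"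
proof -
  have "(\<integral>\<^sup>+u. g (proposal u) \<partial>uniform_measure lborel {0..1}) = (\<integral>\<^sup>+z. g z \<partial>distr (uniform_measure lborel {0..1}) borel proposal)"
    by (subst nn_integral_distr) auto
  then show ?thesis by (simp add: distr_proposal nn_integral_density)
qed

lemma nn_integral_proposal_density: "(\<integral>\<^sup>+z. ennreal (proposal_density z) \<partial>lborel) = 1"
  using nn_integral_uniform_proposal[of "\<lambda>_. 1"] by simp

context scaled_target
begin

section \<open>Acceptance, rejection and repeated trials\<close>

definition accept_mass :: real where
  "accept_mass = enn2real pos_mass"

lemma pos_mass_eq: "pos_mass = ennreal accept_mass"
  using pos_mass_le by (simp add: accept_mass_def le_less_trans[of _ "ennreal _"])

lemma accept_mass_ge_1: "1 \<le> accept_mass"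
  using pos_mass_ge_1 by (simp add: pos_mass_eq)

lemma accept_mass_le: "accept_mass \<le> 1 + tau \<psi> \<sigma>"
  using pos_mass_le tau_nonneg by (simp add: pos_mass_eq del: ennreal_plus)

lemma nn_integral_pos_profile_scaled:
  "0 < m \<Longrightarrow> (\<integral>\<^sup>+z. ennreal (pos_profile z / m) \<partial>lborel) = ennreal (accept_mass / m)"
  using accept_mass_ge_1
  by (simp add: divide_ennreal[symmetric] nn_integral_divide pos_mass_def[symmetric] pos_mass_eq)

lemma accept_mass_le_envelope:
  assumes "0 < m" "\<And>z. pos_profile z \<le> m * proposal_density z"
  shows "accept_mass / m \<le> 1"
proof -
  have "ennreal (accept_mass / m) \<le> (\<integral>\<^sup>+z. ennreal (proposal_density z) \<partial>lborel)"
    unfolding nn_integral_pos_profile_scaled[OF assms(1), symmetric]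
    using assms by (intro nn_integral_mono ennreal_leI) (simp add: pos_divide_le_eq mult.commute)
  then show ?thesis by (simp add: nn_integral_proposal_density)
qed

lemma nn_integral_reject:
  assumes m: "0 < m" "\<And>z. pos_profile z \<le> m * proposal_density z"
  shows "(\<integral>\<^sup>+z. ennreal (proposal_density z - pos_profile z / m) \<partial>lborel) = ennreal (1 - accept_mass / m)"
proof -
  have le: "pos_profile z / m \<le> proposal_density z" for z
    using m by (simp add: pos_divide_le_eq mult.commute)
  have "(\<integral>\<^sup>+z. ennreal (proposal_density z - pos_profile z / m) \<partial>lborel)
      = (\<integral>\<^sup>+z. ennreal (proposal_density z) - ennreal (pos_profile z / m) \<partial>lborel)"
    using m by (intro nn_integral_cong) (simp add: ennreal_minus)
  also have "\<dots> = 1 - ennreal (accept_mass / m)"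
    by (subst nn_integral_diff)
       (auto simp: nn_integral_proposal_density nn_integral_pos_profile_scaled[OF m(1)] intro!: AE_I2 ennreal_leI le)
  also have "\<dots> = ennreal (1 - accept_mass / m)"
    using accept_mass_ge_1 m(1) by (simp add: ennreal_minus ennreal_1[symmetric] del: ennreal_1)
  finally show ?thesis .
qed

text \<open>The proposal density cancels: proposing \<open>z\<close> and accepting it has density
  \<open>pos_profile z / m\<close>, so a trial accepts with probability
  \<open>accept_mass / m\<close>. A rejection leaves register 0, register 1 and the vector
  unchanged, so the next round starts from the same data.\<close>

lemma nn_integral_trial:
  assumes \<phi>: "(\<lambda>s. \<phi> (fst s 0) (fst s 1) (snd s)) \<in> borel_measurable (state_space n)"
    and w: "w \<in> space (obs_space n)"
    and m: "0 < m" "\<And>z. pos_profile z \<le> m * proposal_density z"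
  shows "(\<integral>\<^sup>+s. \<phi> (fst s 0) (fst s 1) (snd s) \<partial>sem \<psi> \<sigma> n (trial \<sigma> (m / (2 * \<sigma>))) (R, w))
    = ennreal (1 - accept_mass / m) * \<phi> (R 0) (R 1) w
      + (\<integral>\<^sup>+z. ennreal (pos_profile z / m) * \<phi> (R 0) (z * \<sigma> + 1 + R 0) w \<partial>lborel)"
proof -
  let ?U = "uniform_measure lborel {0..1::real}"
  define K where "K = \<phi> (R 0) (R 1) w"
  define h where "h y = \<phi> (R 0) y w" for y
  have [measurable]: "h \<in> borel_measurable borel"
    using measurable_compose[OF set_register_measurable[of "\<lambda>_. (R, w)" borel n "\<lambda>y. y" 1] \<phi>] w
    by (simp add: h_def[abs_def])
  define \<rho> where "\<rho> z = pos_profile z / (m * proposal_density z)" for z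
  have [measurable]: "\<rho> \<in> borel_measurable borel" unfolding \<rho>_def by measurable
  have mq: "0 < m * proposal_density z" for z using m proposal_density_pos by simp
  have \<rho>: "0 \<le> \<rho> z" "\<rho> z \<le> 1" for z using m(2)[of z] mq[of z] by (auto simp: \<rho>_def)
  define g where "g z = ennreal (\<rho> z) * h (z * \<sigma> + 1 + R 0) + ennreal (1 - \<rho> z) * K" for z
  have [measurable]: "g \<in> borel_measurable borel" unfolding g_def by measurable
  have "(\<integral>\<^sup>+s. \<phi> (fst s 0) (fst s 1) (snd s) \<partial>sem \<psi> \<sigma> n (trial \<sigma> (m / (2 * \<sigma>))) (R, w))
      = (\<integral>\<^sup>+u. \<integral>\<^sup>+v. (if m / (2 * \<sigma>) * (1 - \<bar>2 * u - 1\<bar>)\<^sup>2 * v \<le> profile (proposal u) / \<sigma>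
          then h (proposal u * \<sigma> + 1 + R 0) else K) \<partial>?U \<partial>?U)"
    unfolding h_def K_def by (rule nn_integral_trial_aux[OF \<phi> w])
  also have "\<dots> = (\<integral>\<^sup>+u. g (proposal u) \<partial>?U)"
  proof (rule nn_integral_cong_AE, use AE_uniform_open in eventually_elim)
    fix u :: real assume u: "0 < u \<and> u < 1"
    let ?z = "proposal u"
    \<comment> \<open>The program constant is chosen for this identity: the factor 1/2 belongs to
      the proposal density, and 1/\<sigma> matches the scaling of the signed kernel.\<close>
    have c: "m / (2 * \<sigma>) * (1 - \<bar>2 * u - 1\<bar>)\<^sup>2 = m * proposal_density ?z / \<sigma>"
      using u by (simp add: one_minus_abs_eq proposal_density_def power_divide)
    have le: "profile ?z \<le> m * proposal_density ?z" using m(2)[of ?z] by (simp add: pos_profile_def)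
    have "max 0 (profile ?z / \<sigma> / (m * proposal_density ?z / \<sigma>)) = \<rho> ?z"
      using sigma_pos mq[of ?z] by (simp add: \<rho>_def pos_profile_def max_def zero_le_divide_iff field_simps not_le)
    then show "(\<integral>\<^sup>+v. (if m / (2 * \<sigma>) * (1 - \<bar>2 * u - 1\<bar>)\<^sup>2 * v \<le> profile ?z / \<sigma>
        then h (?z * \<sigma> + 1 + R 0) else K) \<partial>?U) = g ?z"
      unfolding c g_def using sigma_pos mq[of ?z] le
      by (subst nn_integral_uniform_accept) (auto intro!: divide_right_mono)
  qed
  also have "\<dots> = (\<integral>\<^sup>+z. ennreal (proposal_density z) * g z \<partial>lborel)"
    by (rule nn_integral_uniform_proposal) measurable
  also have "\<dots> = (\<integral>\<^sup>+z. ennreal (proposal_density z - pos_profile z / m) * K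
      + ennreal (pos_profile z / m) * h (z * \<sigma> + 1 + R 0) \<partial>lborel)"
  proof (rule nn_integral_cong)
    fix z
    have "ennreal (proposal_density z) * ennreal (\<rho> z) = ennreal (pos_profile z / m)"
      using mq[of z] m(1) proposal_density_pos[of z] by (simp add: ennreal_mult'[symmetric] \<rho>_def)
    moreover have "ennreal (proposal_density z) * ennreal (1 - \<rho> z) = ennreal (proposal_density z - pos_profile z / m)"
      using mq[of z] m(1) proposal_density_pos[of z] by (simp add: ennreal_mult'[symmetric] \<rho>_def algebra_simps)
    ultimately show "ennreal (proposal_density z) * g z = ennreal (proposal_density z - pos_profile z / m) * K
      + ennreal (pos_profile z / m) * h (z * \<sigma> + 1 + R 0)"
      by (simp add: g_def distrib_left mult.assoc[symmetric] add.commute)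
  qed
  also have "\<dots> = ennreal (1 - accept_mass / m) * K + (\<integral>\<^sup>+z. ennreal (pos_profile z / m) * h (z * \<sigma> + 1 + R 0) \<partial>lborel)"
    by (simp add: nn_integral_add nn_integral_multc nn_integral_reject[OF m])
  finally show ?thesis by (simp add: h_def K_def)
qed

text \<open>\<open>F\<close> is the final reward and \<open>I\<close> the expected gain of an
  accepting round, not decreased in mean by a round. Unrolling gives the geometric series times
  \<open>I\<close> plus a nonnegative term for the initial value of \<open>F\<close>, which is
  dropped.\<close>

lemma nn_integral_Repeat_ge:
  assumes F: "F \<in> borel_measurable (state_space n)" and I: "I \<in> borel_measurable (state_space n)"
    and step: "\<And>s. s \<in> space (state_space n) \<Longrightarrow> r * F s + I s \<le> (\<integral>\<^sup>+t. F t \<partial>sem \<psi> \<sigma> n c s)"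
    and inv: "\<And>s. s \<in> space (state_space n) \<Longrightarrow> I s \<le> (\<integral>\<^sup>+t. I t \<partial>sem \<psi> \<sigma> n c s)"
    and s: "s \<in> space (state_space n)"
  shows "(\<Sum>j<k. r ^ j) * I s \<le> (\<integral>\<^sup>+t. F t \<partial>sem \<psi> \<sigma> n (Repeat k c) s)"
    and "I s \<le> (\<integral>\<^sup>+t. I t \<partial>sem \<psi> \<sigma> n (Repeat k c) s)"
proof -
  have Suc_eq: "(\<integral>\<^sup>+t. H t \<partial>sem \<psi> \<sigma> n (Repeat (Suc k) c) s)
      = (\<integral>\<^sup>+t. \<integral>\<^sup>+t'. H t' \<partial>sem \<psi> \<sigma> n c t \<partial>sem \<psi> \<sigma> n (Repeat k c) s)"
    if "H \<in> borel_measurable (state_space n)" for H k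
    using nn_integral_Seq[OF that s, of "Repeat k c" c] by simp
  have sets: "sets (sem \<psi> \<sigma> n (Repeat k c) s) = sets (state_space n)" for k by (rule sets_sem[OF s])
  then have space: "space (sem \<psi> \<sigma> n (Repeat k c) s) = space (state_space n)" for k by (rule sets_eq_imp_space_eq)
  have meas: "H \<in> borel_measurable (sem \<psi> \<sigma> n (Repeat k c) s)" if "H \<in> borel_measurable (state_space n)" for H :: "state \<Rightarrow> ennreal" and k
    using that measurable_cong_sets[OF sets refl] by blast
  have I_le: "I s \<le> (\<integral>\<^sup>+t. I t \<partial>sem \<psi> \<sigma> n (Repeat k c) s)" for k
  proof (induction k)
    case 0
    show ?case using s I by (simp add: nn_integral_return)
  next
    case (Suc k)
    also have "(\<integral>\<^sup>+t. I t \<partial>sem \<psi> \<sigma> n (Repeat k c) s) \<le> (\<integral>\<^sup>+t. \<integral>\<^sup>+t'. I t' \<partial>sem \<psi> \<sigma> n c t \<partial>sem \<psi> \<sigma> n (Repeat k c) s)"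
      using inv by (intro nn_integral_mono) (simp only: space)
    finally show ?case unfolding Suc_eq[OF I] .
  qed
  then show "I s \<le> (\<integral>\<^sup>+t. I t \<partial>sem \<psi> \<sigma> n (Repeat k c) s)" .
  show "(\<Sum>j<k. r ^ j) * I s \<le> (\<integral>\<^sup>+t. F t \<partial>sem \<psi> \<sigma> n (Repeat k c) s)"
  proof (induction k)
    case (Suc k)
    have "(\<Sum>j<Suc k. r ^ j) * I s = r * ((\<Sum>j<k. r ^ j) * I s) + I s"
      unfolding sum.lessThan_Suc_shift by (simp add: sum_distrib_left[symmetric] distrib_right mult.assoc add.commute)
    also have "\<dots> \<le> r * (\<integral>\<^sup>+t. F t \<partial>sem \<psi> \<sigma> n (Repeat k c) s) + (\<integral>\<^sup>+t. I t \<partial>sem \<psi> \<sigma> n (Repeat k c) s)"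
      by (intro add_mono mult_left_mono Suc.IH I_le) auto
    also have "\<dots> = (\<integral>\<^sup>+t. r * F t + I t \<partial>sem \<psi> \<sigma> n (Repeat k c) s)"
      using meas[OF F] meas[OF I] by (simp add: nn_integral_add nn_integral_cmult)
    also have "\<dots> \<le> (\<integral>\<^sup>+t. \<integral>\<^sup>+t'. F t' \<partial>sem \<psi> \<sigma> n c t \<partial>sem \<psi> \<sigma> n (Repeat k c) s)"
      using step by (intro nn_integral_mono) (simp only: space)
    finally show ?case unfolding Suc_eq[OF F] .
  qed simp
qed

text \<open>The idealized, unnormalized step: entry \<open>i\<close> moves by 1 + \<sigma> z, with
  \<open>z\<close> weighted by s^+ instead of the law of an accepted sample. The normalization is
  collected in scalar factors.\<close>

definition entry_operator :: "nat \<Rightarrow> ((nat \<Rightarrow> real option) \<Rightarrow> ennreal) \<Rightarrow> (nat \<Rightarrow> real option) \<Rightarrow> ennreal" where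
  "entry_operator i G w = (\<integral>\<^sup>+z. ennreal (pos_profile z) * G (w(i := Some (z * \<sigma> + 1 + entry_value (w i)))) \<partial>lborel)"

lemma entry_operator_measurable:
  assumes "i \<in> {1..n}" and [measurable]: "G \<in> borel_measurable (obs_space n)"
  shows "entry_operator i G \<in> borel_measurable (obs_space n)"
proof -
  have [measurable]: "(\<lambda>x. (fst x)(i := Some (snd x * \<sigma> + 1 + entry_value (fst x i)))) \<in> obs_space n \<Otimes>\<^sub>M borel \<rightarrow>\<^sub>M obs_space n"
    using assms(1) by (intro store_measurable) (auto intro!: borel_measurable_add borel_measurable_times measurable_compose[OF measurable_fst] measurable_compose[OF entry_measurable entry_value_measurable])
  have "(\<lambda>x. ennreal (pos_profile (snd x)) * G ((fst x)(i := Some (snd x * \<sigma> + 1 + entry_value (fst x i))))) \<in> borel_measurable (obs_space n \<Otimes>\<^sub>M lborel)"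
    by measurable
  then show ?thesis unfolding entry_operator_def
    by (intro lborel.borel_measurable_nn_integral) (simp add: case_prod_unfold)
qed

text \<open>The scalar is the probability that one of \<open>k\<close> trials accepts, divided by
  the mass of s^+: the geometric series with ratio 1 - P/m, times the factor 1/m carried by each
  acceptance.\<close>

lemma nn_integral_entry_ge:
  assumes i: "i \<in> {1..n}" and G: "G \<in> borel_measurable (obs_space n)"
    and w: "w \<in> space (obs_space n)"
    and m: "0 < m" "\<And>z. pos_profile z \<le> m * proposal_density z"
  shows "ennreal ((1 - (1 - accept_mass / m) ^ k) / accept_mass) * entry_operator i G w
    \<le> (\<integral>\<^sup>+t. G (snd t) \<partial>sem \<psi> \<sigma> n (entry \<sigma> (m / (2 * \<sigma>)) k i) (R, w))"
proof -
  let ?c = "trial \<sigma> (m / (2 * \<sigma>))"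
  let ?P = accept_mass
  define \<phi> where "\<phi> x y w = G (w(i := Some y))" for x y :: real and w
  define I where "I x w = (\<integral>\<^sup>+z. ennreal (pos_profile z / m) * G (w(i := Some (z * \<sigma> + 1 + x))) \<partial>lborel)" for x w
  have P: "0 < ?P" "0 \<le> ?P / m" "?P / m \<le> 1"
    using accept_mass_ge_1 m(1) accept_mass_le_envelope[OF m] by auto
  have \<phi>: "(\<lambda>s. \<phi> (fst s 0) (fst s 1) (snd s)) \<in> borel_measurable (state_space n)"
    unfolding \<phi>_def using i by (intro measurable_compose[OF store_measurable G]) auto
  have "(\<lambda>x. G ((snd (fst x))(i := Some (snd x * \<sigma> + 1 + fst (fst x) 0)))) \<in> borel_measurable (state_space n \<Otimes>\<^sub>M borel)"
    using i by (intro measurable_compose[OF store_measurable G])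
      (auto intro!: borel_measurable_add borel_measurable_times measurable_compose[OF measurable_fst])
  then have "(\<lambda>x. ennreal (pos_profile (snd x) / m) * G ((snd (fst x))(i := Some (snd x * \<sigma> + 1 + fst (fst x) 0)))) \<in> borel_measurable (state_space n \<Otimes>\<^sub>M lborel)"
    by (intro borel_measurable_times_ennreal) (auto cong: measurable_cong_sets)
  then have I: "(\<lambda>s. I (fst s 0) (snd s)) \<in> borel_measurable (state_space n)"
    unfolding I_def by (intro lborel.borel_measurable_nn_integral) (simp add: case_prod_unfold)
  have step: "ennreal (1 - ?P / m) * \<phi> (fst s 0) (fst s 1) (snd s) + I (fst s 0) (snd s)
      = (\<integral>\<^sup>+t. \<phi> (fst t 0) (fst t 1) (snd t) \<partial>sem \<psi> \<sigma> n ?c s)" if "s \<in> space (state_space n)" for s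
  proof (cases s)
    case (Pair R' w')
    then show ?thesis using that nn_integral_trial[OF \<phi> _ m, of w' R'] by (simp add: I_def \<phi>_def)
  qed
  \<comment> \<open>\<open>I\<close> ignores register 1, so rejection and acceptance both return it,
    with weights that add up to 1.\<close>
  have inv: "I (fst s 0) (snd s) = (\<integral>\<^sup>+t. I (fst t 0) (snd t) \<partial>sem \<psi> \<sigma> n ?c s)" if "s \<in> space (state_space n)" for s
  proof (cases s)
    case (Pair R' w')
    then have "(\<integral>\<^sup>+t. I (fst t 0) (snd t) \<partial>sem \<psi> \<sigma> n ?c s)
        = ennreal (1 - ?P / m) * I (R' 0) w' + ennreal (?P / m) * I (R' 0) w'"
      using that nn_integral_trial[of "\<lambda>x y w. I x w", OF I _ m, of w' R']
      by (simp add: nn_integral_multc nn_integral_pos_profile_scaled m)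
    also have "\<dots> = I (R' 0) w'"
      using P by (simp add: distrib_right[symmetric] ennreal_plus[symmetric] del: ennreal_plus)
    finally show ?thesis using Pair by simp
  qed
  let ?R = "R(0 := entry_value (w i))"
  have I_eq: "ennreal m * I (entry_value (w i)) w = entry_operator i G w"
  proof -
    have [measurable]: "(\<lambda>z. G (w(i := Some (z * \<sigma> + 1 + entry_value (w i))))) \<in> borel_measurable borel"
      using i w by (intro measurable_compose[OF store_measurable G]) auto
    show ?thesis unfolding I_def entry_operator_def
      using m(1) by (subst nn_integral_cmult[symmetric]) (auto simp: mult.assoc[symmetric] ennreal_mult'[symmetric])
  qed
  have sum: "(\<Sum>j<k. ennreal (1 - ?P / m) ^ j) = ennreal ((1 - (1 - ?P / m) ^ k) / (?P / m))"
  proof -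
    have "(\<Sum>j<k. ennreal (1 - ?P / m) ^ j) = ennreal (\<Sum>j<k. (1 - ?P / m) ^ j)"
      using P by (simp add: ennreal_power sum_ennreal)
    also have "(\<Sum>j<k. (1 - ?P / m) ^ j) = (1 - (1 - ?P / m) ^ k) / (?P / m)"
      using P m(1) by (subst sum_gp_strict) auto
    finally show ?thesis .
  qed
  have "ennreal ((1 - (1 - ?P / m) ^ k) / ?P) * entry_operator i G w
      = (\<Sum>j<k. ennreal (1 - ?P / m) ^ j) * I (entry_value (w i)) w"
    unfolding I_eq[symmetric] sum using P m(1)
    by (simp add: mult.assoc[symmetric] ennreal_mult''[symmetric])
  also have "\<dots> \<le> (\<integral>\<^sup>+t. \<phi> (fst t 0) (fst t 1) (snd t) \<partial>sem \<psi> \<sigma> n (Repeat k ?c) (?R, w))"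
    using nn_integral_Repeat_ge(1)[OF \<phi> I, of "ennreal (1 - ?P / m)" ?c "(?R, w)" k] step inv w by simp
  also have "\<dots> = (\<integral>\<^sup>+t. G (snd t) \<partial>sem \<psi> \<sigma> n (block [Repeat k ?c, Store i 1]) (?R, w))"
  proof -
    have ws: "(?R, w) \<in> space (state_space n)" using w by simp
    have G': "(\<lambda>t. G (snd t)) \<in> borel_measurable (state_space n)"
      by (rule measurable_compose[OF vector_measurable G])
    show ?thesis unfolding block_Cons[of "Repeat _ _"] nn_integral_Seq[OF G' ws]
    proof (rule nn_integral_cong)
      fix t assume "t \<in> space (sem \<psi> \<sigma> n (Repeat k ?c) (?R, w))"
      then have "t \<in> space (state_space n)" using sets_eq_imp_space_eq[OF sets_sem[OF ws]] by blast
      then obtain R' w' where t: "t = (R', w')" "w' \<in> space (obs_space n)" by (cases t) auto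
      show "\<phi> (fst t 0) (fst t 1) (snd t) = (\<integral>\<^sup>+t'. G (snd t') \<partial>sem \<psi> \<sigma> n (block [Store i 1]) t)"
        using t i G' by (simp add: sem_block(7) nn_integral_return store_in_space \<phi>_def)
    qed
  qed
  finally show ?thesis using w i by (simp add: entry_def sem_block)
qed

end

section \<open>Observation vectors and total variation\<close>

text \<open>Generalizes \<open>observe\<close> to an arbitrary background vector, so that an
  induction can fill the coordinates one at a time.\<close>

definition splice_obs :: "nat \<Rightarrow> nat set \<Rightarrow> (nat \<Rightarrow> real) \<Rightarrow> (nat \<Rightarrow> real option) \<Rightarrow> (nat \<Rightarrow> real) \<Rightarrow> (nat \<Rightarrow> real option)" where
  "splice_obs n S \<theta> w \<xi> = (\<lambda>j\<in>{1..n}. if j \<in> S then Some (\<theta> j + \<xi> j) else w j)"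

lemma splice_obs_measurable:
  assumes "w \<in> N \<rightarrow>\<^sub>M obs_space n" "\<xi> \<in> N \<rightarrow>\<^sub>M (\<Pi>\<^sub>M i\<in>S. borel)"
  shows "(\<lambda>x. splice_obs n S \<theta> (w x) (\<xi> x)) \<in> N \<rightarrow>\<^sub>M obs_space n"
  unfolding splice_obs_def obs_space_def
proof (rule measurable_restrict)
  fix j assume j: "j \<in> {1..n}"
  show "(\<lambda>x. if j \<in> S then Some (\<theta> j + \<xi> x j) else w x j) \<in> N \<rightarrow>\<^sub>M star_borel"
  proof (cases "j \<in> S")
    case True
    then have "(\<lambda>x. \<xi> x j) \<in> N \<rightarrow>\<^sub>M borel"
      using measurable_compose[OF assms(2) measurable_component_singleton] by simp
    with True show ?thesis by simp
  next
    case False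
    with j show ?thesis using measurable_compose[OF assms(1) entry_measurable[OF j]] by simp
  qed
qed

lemma sets_source_noise [simp]: "sets source_noise = sets borel"
  by (simp add: source_noise_def)

lemma sets_target_noise [simp]: "sets (target_noise \<psi> \<sigma>) = sets borel"
  by (simp add: target_noise_def)

text \<open>The source noise is a standard exponential variable minus 1; the shift cancels the + 1
  in the location of the kernel.\<close>

lemma nn_integral_source_noise:
  assumes [measurable]: "g \<in> borel_measurable borel"
  shows "(\<integral>\<^sup>+x. g x \<partial>source_noise) = (\<integral>\<^sup>+e. ennreal (exp (- e)) * indicator {0..} e * g (e - 1) \<partial>lborel)"
proof -
  have "(\<integral>\<^sup>+x. g x \<partial>source_noise) = (\<integral>\<^sup>+x. ennreal (if x \<ge> -1 then exp (- x - 1) else 0) * g x \<partial>lborel)"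
    unfolding source_noise_def by (subst nn_integral_density) auto
  also have "\<dots> = (\<integral>\<^sup>+e. ennreal (if - 1 + 1 * e \<ge> -1 then exp (- (- 1 + 1 * e) - 1) else 0) * g (- 1 + 1 * e) \<partial>lborel)"
    by (subst nn_integral_real_affine[where c = 1 and t = "-1"]) auto
  also have "\<dots> = (\<integral>\<^sup>+e. ennreal (exp (- e)) * indicator {0..} e * g (e - 1) \<partial>lborel)"
    by (intro nn_integral_cong) (auto split: split_indicator)
  finally show ?thesis .
qed

text \<open>Domination bounds Q A - P A by 1 - c; the complement of \<open>A\<close> supplies the
  opposite sign.\<close>

lemma tv_dist_le:
  assumes "prob_space P" "prob_space Q" "sets P = sets Q" "c \<le> 1"
    and dom: "\<And>A. A \<in> sets P \<Longrightarrow> c * measure Q A \<le> measure P A"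
  shows "tv_dist P Q \<le> 1 - c"
proof -
  interpret P: prob_space P by fact
  interpret Q: prob_space Q by fact
  have le: "measure Q A - measure P A \<le> 1 - c" if "A \<in> sets P" for A
  proof -
    have "measure Q A - measure P A \<le> (1 - c) * measure Q A" using dom[OF that] by (simp add: algebra_simps)
    also have "\<dots> \<le> (1 - c) * 1" using assms(4) by (intro mult_left_mono) auto
    finally show ?thesis by simp
  qed
  have "\<bar>measure P A - measure Q A\<bar> \<le> 1 - c" if "A \<in> sets P" for A
  proof -
    have "measure Q (space P - A) = 1 - measure Q A" "measure P (space P - A) = 1 - measure P A"
      using that assms(3) sets_eq_imp_space_eq[OF assms(3)] P.prob_compl[of A] Q.prob_compl[of A] by auto
    with le[OF that] le[of "space P - A"] that show ?thesis by auto
  qed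
  then show ?thesis unfolding tv_dist_def by (intro cSUP_least) auto
qed

context scaled_target
begin

lemma prob_space_source_noise: "prob_space source_noise"
proof (rule prob_spaceI)
  have "emeasure source_noise (space source_noise) = (\<integral>\<^sup>+x. 1 \<partial>source_noise)" by simp
  also have "\<dots> = 1" by (subst nn_integral_source_noise) (auto simp: nn_integral_exp)
  finally show "emeasure source_noise (space source_noise) = 1" .
qed

lemma target_noise_eq: "target_noise \<psi> \<sigma> = distr (density lborel (\<lambda>z. ennreal (f z))) borel (\<lambda>z. 0 + \<sigma> * z)"
  using sigma_pos by (subst distr_affine_density) (auto simp: target_noise_def)

lemma prob_space_target_noise: "prob_space (target_noise \<psi> \<sigma>)"
  unfolding target_noise_eq by (rule prob_space.prob_space_distr[OF prob_space_density]) simp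

lemma nn_integral_target_noise:
  assumes [measurable]: "g \<in> borel_measurable borel"
  shows "(\<integral>\<^sup>+y. g y \<partial>target_noise \<psi> \<sigma>) = (\<integral>\<^sup>+z. ennreal (f z) * g (\<sigma> * z) \<partial>lborel)"
  unfolding target_noise_eq by (simp add: nn_integral_distr nn_integral_density)

text \<open>The smoothing inequality for one observed entry: noise e - 1 followed by the move 1 +
  \<sigma> z' ends at t + \<sigma> z with z = z' + e/\<sigma>.\<close>

lemma source_pos_profile_ge_target:
  assumes [measurable]: "h \<in> borel_measurable borel"
  shows "(\<integral>\<^sup>+e. h (t + e) \<partial>target_noise \<psi> \<sigma>)
    \<le> (\<integral>\<^sup>+e. \<integral>\<^sup>+z. ennreal (pos_profile z) * h (z * \<sigma> + 1 + (t + e)) \<partial>lborel \<partial>source_noise)"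
proof -
  let ?w = "\<lambda>e. ennreal (exp (- e)) * indicator {0..} e"
  have shift: "(\<integral>\<^sup>+z. ennreal (pos_profile z) * h (z * \<sigma> + 1 + (t + (e - 1))) \<partial>lborel)
      = (\<integral>\<^sup>+z. ennreal (pos_profile (z - e / \<sigma>)) * h (t + \<sigma> * z) \<partial>lborel)" for e
    by (subst nn_integral_real_affine[where c = 1 and t = "- (e / \<sigma>)"])
       (use sigma_pos in \<open>auto simp: algebra_simps\<close>)
  have "(\<integral>\<^sup>+e. h (t + e) \<partial>target_noise \<psi> \<sigma>) = (\<integral>\<^sup>+z. ennreal (f z) * h (t + \<sigma> * z) \<partial>lborel)"
    by (rule nn_integral_target_noise) measurable
  also have "\<dots> \<le> (\<integral>\<^sup>+z. (\<integral>\<^sup>+e. ennreal (exp (- e) * pos_profile (z - e / \<sigma>)) * indicator {0..} e \<partial>lborel) * h (t + \<sigma> * z) \<partial>lborel)"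
    by (intro nn_integral_mono mult_right_mono density_le_exp_smoothing) auto
  also have "\<dots> = (\<integral>\<^sup>+z. \<integral>\<^sup>+e. ?w e * (ennreal (pos_profile (z - e / \<sigma>)) * h (t + \<sigma> * z)) \<partial>lborel \<partial>lborel)"
    by (subst nn_integral_multc[symmetric]) (auto simp: ennreal_mult' mult_ac intro!: nn_integral_cong)
  also have "\<dots> = (\<integral>\<^sup>+e. \<integral>\<^sup>+z. ?w e * (ennreal (pos_profile (z - e / \<sigma>)) * h (t + \<sigma> * z)) \<partial>lborel \<partial>lborel)"
    by (intro lborel_pair.Fubini') measurable
  also have "\<dots> = (\<integral>\<^sup>+e. ?w e * (\<integral>\<^sup>+z. ennreal (pos_profile z) * h (z * \<sigma> + 1 + (t + (e - 1))) \<partial>lborel) \<partial>lborel)"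
    unfolding shift by (simp add: nn_integral_cmult)
  also have "\<dots> = (\<integral>\<^sup>+e. \<integral>\<^sup>+z. ennreal (pos_profile z) * h (z * \<sigma> + 1 + (t + e)) \<partial>lborel \<partial>source_noise)"
    by (subst nn_integral_source_noise) measurable
  finally show ?thesis .
qed

lemma foldr_entry_operator_measurable:
  "set L \<subseteq> {1..n} \<Longrightarrow> G \<in> borel_measurable (obs_space n) \<Longrightarrow> foldr entry_operator L G \<in> borel_measurable (obs_space n)"
  by (induction L) (auto intro: entry_operator_measurable)

lemma entry_operator_cmult:
  assumes "i \<in> {1..n}" "G \<in> borel_measurable (obs_space n)" "w \<in> space (obs_space n)"
  shows "entry_operator i (\<lambda>w. c * G w) w = c * entry_operator i G w"
proof -
  have "(\<lambda>z. G (w(i := Some (z * \<sigma> + 1 + entry_value (w i))))) \<in> borel_measurable borel"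
    using assms by (intro measurable_compose[OF store_measurable assms(2)]) auto
  then show ?thesis unfolding entry_operator_def
    by (subst nn_integral_cmult[symmetric]) (auto simp: mult_ac)
qed

text \<open>Registers are arbitrary because each entry inherits those left by its predecessor. The
  first entry executed contributes the outermost operator, hence the right fold.\<close>

lemma nn_integral_program_ge:
  assumes L: "set L \<subseteq> {1..n}" and G: "G \<in> borel_measurable (obs_space n)"
    and w: "w \<in> space (obs_space n)"
    and m: "0 < m" "\<And>z. pos_profile z \<le> m * proposal_density z"
  shows "ennreal ((1 - (1 - accept_mass / m) ^ k) / accept_mass) ^ length L * foldr entry_operator L G w
    \<le> (\<integral>\<^sup>+t. G (snd t) \<partial>sem \<psi> \<sigma> n (block (map (entry \<sigma> (m / (2 * \<sigma>)) k) L)) (R, w))"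
  using L w
proof (induction L arbitrary: R w)
  case Nil
  have "(\<lambda>t. G (snd t)) \<in> borel_measurable (state_space n)" by (rule measurable_compose[OF vector_measurable G])
  with Nil show ?case by (simp add: nn_integral_return)
next
  case (Cons i L)
  let ?c = "ennreal ((1 - (1 - accept_mass / m) ^ k) / accept_mass)"
  let ?H = "\<lambda>w. ?c ^ length L * foldr entry_operator L G w"
  let ?e = "entry \<sigma> (m / (2 * \<sigma>)) k"
  have meas: "foldr entry_operator L G \<in> borel_measurable (obs_space n)"
    using Cons.prems by (intro foldr_entry_operator_measurable G) auto
  have ws: "(R, w) \<in> space (state_space n)" using Cons.prems by simp
  have "?c ^ length (i # L) * foldr entry_operator (i # L) G w = ?c * entry_operator i ?H w"
    using Cons.prems by (simp add: entry_operator_cmult[OF _ meas] mult.assoc)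
  also have "\<dots> \<le> (\<integral>\<^sup>+t. ?H (snd t) \<partial>sem \<psi> \<sigma> n (?e i) (R, w))"
    using Cons.prems meas by (intro nn_integral_entry_ge m borel_measurable_times_ennreal) auto
  also have "\<dots> \<le> (\<integral>\<^sup>+t. \<integral>\<^sup>+t'. G (snd t') \<partial>sem \<psi> \<sigma> n (block (map ?e L)) t \<partial>sem \<psi> \<sigma> n (?e i) (R, w))"
  proof (rule nn_integral_mono)
    fix t assume "t \<in> space (sem \<psi> \<sigma> n (?e i) (R, w))"
    then have "t \<in> space (state_space n)" using sets_eq_imp_space_eq[OF sets_sem[OF ws]] by blast
    then obtain R' w' where "t = (R', w')" "w' \<in> space (obs_space n)" by (cases t) auto
    then show "?H (snd t) \<le> (\<integral>\<^sup>+t'. G (snd t') \<partial>sem \<psi> \<sigma> n (block (map ?e L)) t)"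
      using Cons.IH[of w' R'] Cons.prems by simp
  qed
  also have "\<dots> = (\<integral>\<^sup>+t. G (snd t) \<partial>sem \<psi> \<sigma> n (block (map ?e (i # L))) (R, w))"
    unfolding list.map block_Cons
    by (rule nn_integral_Seq[OF measurable_compose[OF vector_measurable G] ws, symmetric])
  finally show ?case .
qed

text \<open>Tensorization: the noise is exchanged coordinate by coordinate. Distinctness lets entry
  \<open>i\<close> be fixed while the operators of the remaining list act on theirs.\<close>

lemma nn_integral_source_operators_ge:
  assumes "distinct L" "set L \<subseteq> {1..n}" "G \<in> borel_measurable (obs_space n)" "w \<in> space (obs_space n)"
  shows "(\<integral>\<^sup>+\<xi>. G (splice_obs n (set L) \<theta> w \<xi>) \<partial>(\<Pi>\<^sub>M i\<in>set L. target_noise \<psi> \<sigma>))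
    \<le> (\<integral>\<^sup>+\<xi>. foldr entry_operator L G (splice_obs n (set L) \<theta> w \<xi>) \<partial>(\<Pi>\<^sub>M i\<in>set L. source_noise))"
  using assms(1,2,4)
proof (induction L arbitrary: w)
  case Nil
  interpret product_sigma_finite "\<lambda>_. source_noise"
    by (simp add: product_sigma_finite_def prob_space_source_noise prob_space_imp_sigma_finite)
  interpret T: product_sigma_finite "\<lambda>_. target_noise \<psi> \<sigma>"
    by (simp add: product_sigma_finite_def prob_space_target_noise prob_space_imp_sigma_finite)
  show ?case by (simp add: nn_integral_empty T.nn_integral_empty PiM_empty nn_integral_count_space_finite)
next
  case (Cons i L)
  interpret S: product_sigma_finite "\<lambda>_::nat. source_noise"
    by (simp add: product_sigma_finite_def prob_space_source_noise prob_space_imp_sigma_finite)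
  interpret T: product_sigma_finite "\<lambda>_::nat. target_noise \<psi> \<sigma>"
    by (simp add: product_sigma_finite_def prob_space_target_noise prob_space_imp_sigma_finite)
  let ?S = "set L"
  let ?PS = "\<Pi>\<^sub>M i\<in>?S. source_noise" and ?PT = "\<Pi>\<^sub>M i\<in>?S. target_noise \<psi> \<sigma>"
  define H where "H = foldr entry_operator L G"
  have i: "i \<in> {1..n}" "i \<notin> ?S" and L: "?S \<subseteq> {1..n}" and w: "w \<in> space (obs_space n)"
    using Cons.prems by auto
  have H: "H \<in> borel_measurable (obs_space n)"
    unfolding H_def using L assms(3) by (rule foldr_entry_operator_measurable)
  have sets_PS: "sets ?PS = sets (\<Pi>\<^sub>M i\<in>?S. borel)" and sets_PT: "sets ?PT = sets (\<Pi>\<^sub>M i\<in>?S. borel)"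
    by (auto intro!: sets_PiM_cong)
  have sets_PS': "sets (\<Pi>\<^sub>M i\<in>insert i ?S. source_noise) = sets (\<Pi>\<^sub>M i\<in>insert i ?S. borel)"
    and sets_PT': "sets (\<Pi>\<^sub>M i\<in>insert i ?S. target_noise \<psi> \<sigma>) = sets (\<Pi>\<^sub>M i\<in>insert i ?S. borel)"
    by (auto intro!: sets_PiM_cong)
  have splice: "splice_obs n (insert i ?S) \<theta> w (\<xi>(i := e)) = splice_obs n ?S \<theta> (w(i := Some (\<theta> i + e))) \<xi>" for \<xi> e
    using i by (auto simp: splice_obs_def fun_eq_iff restrict_def)
  have upd: "(splice_obs n (insert i ?S) \<theta> w (\<xi>(i := e)))(i := Some y) = splice_obs n ?S \<theta> (w(i := Some y)) \<xi>" for \<xi> e y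
    using i by (auto simp: splice_obs_def fun_eq_iff restrict_def)
  have val: "entry_value (splice_obs n (insert i ?S) \<theta> w (\<xi>(i := e)) i) = \<theta> i + e" for \<xi> e
    using i by (simp add: splice_obs_def entry_value_def)
  have pair: "(\<lambda>p. splice_obs n ?S \<theta> (w(i := Some (fst p))) (snd p)) \<in> borel \<Otimes>\<^sub>M (\<Pi>\<^sub>M i\<in>?S. borel) \<rightarrow>\<^sub>M obs_space n"
    using i w by (intro splice_obs_measurable store_measurable) auto
  have G_pair: "(\<lambda>p. F (splice_obs n ?S \<theta> (w(i := Some (\<theta> i + fst p))) (snd p))) \<in> borel_measurable (borel \<Otimes>\<^sub>M (\<Pi>\<^sub>M i\<in>?S. borel))"
    if "F \<in> borel_measurable (obs_space n)" for F :: "_ \<Rightarrow> ennreal"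
    using i w that by (intro measurable_compose[OF _ that] splice_obs_measurable store_measurable) auto
  have "(\<integral>\<^sup>+\<xi>. G (splice_obs n (set (i # L)) \<theta> w \<xi>) \<partial>(\<Pi>\<^sub>M i\<in>set (i # L). target_noise \<psi> \<sigma>))
      = (\<integral>\<^sup>+e. \<integral>\<^sup>+\<xi>. G (splice_obs n ?S \<theta> (w(i := Some (\<theta> i + e))) \<xi>) \<partial>?PT \<partial>target_noise \<psi> \<sigma>)"
    unfolding list.set splice[symmetric]
    using i w by (intro T.product_nn_integral_insert_rev)
      (auto intro!: measurable_compose[OF _ assms(3)] splice_obs_measurable simp: measurable_cong_sets[OF sets_PT' refl])
  also have "\<dots> \<le> (\<integral>\<^sup>+e. \<integral>\<^sup>+\<xi>. H (splice_obs n ?S \<theta> (w(i := Some (\<theta> i + e))) \<xi>) \<partial>?PS \<partial>target_noise \<psi> \<sigma>)"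
    unfolding H_def using Cons.prems by (intro nn_integral_mono Cons.IH store_in_space) auto
  \<comment> \<open>The remaining coordinates already carry source noise; Fubini moves coordinate
    \<open>i\<close> inside, where the one-entry inequality applies for fixed \<xi>.\<close>
  also have "\<dots> = (\<integral>\<^sup>+\<xi>. \<integral>\<^sup>+e. H (splice_obs n ?S \<theta> (w(i := Some (\<theta> i + e))) \<xi>) \<partial>target_noise \<psi> \<sigma> \<partial>?PS)"
  proof -
    interpret A: sigma_finite_measure ?PS by (rule S.sigma_finite) simp
    interpret B: sigma_finite_measure "target_noise \<psi> \<sigma>" by (rule prob_space_imp_sigma_finite[OF prob_space_target_noise])
    interpret pair_sigma_finite "target_noise \<psi> \<sigma>" ?PS ..
    have "sets (target_noise \<psi> \<sigma> \<Otimes>\<^sub>M ?PS) = sets (borel \<Otimes>\<^sub>M (\<Pi>\<^sub>M i\<in>?S. borel))"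
      by (intro sets_pair_measure_cong sets_PS) simp
    then show ?thesis
      using G_pair[OF H] by (intro Fubini'[symmetric]) (simp add: case_prod_unfold cong: measurable_cong_sets)
  qed
  also have "\<dots> \<le> (\<integral>\<^sup>+\<xi>. \<integral>\<^sup>+e. entry_operator i H (splice_obs n (insert i ?S) \<theta> w (\<xi>(i := e))) \<partial>source_noise \<partial>?PS)"
  proof (rule nn_integral_mono)
    fix \<xi> assume "\<xi> \<in> space ?PS"
    then have \<xi>: "\<xi> \<in> space (\<Pi>\<^sub>M i\<in>?S. borel)" using sets_eq_imp_space_eq[OF sets_PS] by blast
    let ?h = "\<lambda>y. H (splice_obs n ?S \<theta> (w(i := Some y)) \<xi>)"
    have "?h \<in> borel_measurable borel"
      using measurable_compose[OF measurable_compose[OF measurable_Pair[OF measurable_ident measurable_const[OF \<xi>]] pair] H] by simp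
    from source_pos_profile_ge_target[OF this, of "\<theta> i"]
    show "(\<integral>\<^sup>+e. H (splice_obs n ?S \<theta> (w(i := Some (\<theta> i + e))) \<xi>) \<partial>target_noise \<psi> \<sigma>)
        \<le> (\<integral>\<^sup>+e. entry_operator i H (splice_obs n (insert i ?S) \<theta> w (\<xi>(i := e))) \<partial>source_noise)"
      by (simp add: entry_operator_def val upd)
  qed
  also have "\<dots> = (\<integral>\<^sup>+\<xi>. entry_operator i H (splice_obs n (set (i # L)) \<theta> w \<xi>) \<partial>(\<Pi>\<^sub>M i\<in>set (i # L). source_noise))"
    unfolding list.set using i w
    by (intro S.product_nn_integral_insert[symmetric])
      (auto intro!: measurable_compose[OF _ entry_operator_measurable[OF i(1) H]] splice_obs_measurable simp: measurable_cong_sets[OF sets_PS' refl])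
  finally show ?case by (simp add: H_def)
qed

section \<open>The whole program: domination, error and running time\<close>

definition algorithm :: "real \<Rightarrow> nat \<Rightarrow> nat set \<Rightarrow> cmd" where
  "algorithm m k \<Omega> = block (map (entry \<sigma> (m / (2 * \<sigma>)) k) (sorted_list_of_set \<Omega>))"

definition output_law :: "nat \<Rightarrow> cmd \<Rightarrow> (nat \<Rightarrow> real option) \<Rightarrow> (nat \<Rightarrow> real option) measure" where
  "output_law n c w = distr (sem \<psi> \<sigma> n c (\<lambda>_. 0, w)) (obs_space n) snd"

lemma output_law_measurable: "output_law n c \<in> obs_space n \<rightarrow>\<^sub>M prob_algebra (obs_space n)"
proof -
  have "(\<lambda>w. (\<lambda>_. 0, w)) \<in> obs_space n \<rightarrow>\<^sub>M state_space n"
    unfolding state_space_def by (intro measurable_Pair measurable_const) (auto simp: space_PiM)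
  from measurable_compose[OF measurable_compose[OF this measurable_sem] measurable_distr_prob_space[OF vector_measurable]]
  show ?thesis unfolding output_law_def[abs_def] .
qed

lemma observe_eq: "observe n \<Omega> \<theta> = splice_obs n \<Omega> \<theta> (\<lambda>_\<in>{1..n}. None)"
  by (auto simp: observe_def splice_obs_def fun_eq_iff)

lemma blank_in_space: "(\<lambda>_\<in>{1..n}. None) \<in> space (obs_space n)"
  by (simp add: space_obs_space)

lemma observe_measurable:
  assumes "sets \<nu> = sets borel"
  shows "observe n \<Omega> \<theta> \<in> (\<Pi>\<^sub>M i\<in>\<Omega>. \<nu>) \<rightarrow>\<^sub>M obs_space n"
proof -
  have "sets (\<Pi>\<^sub>M i\<in>\<Omega>. \<nu>) = sets (\<Pi>\<^sub>M i\<in>\<Omega>. borel)" using assms by (intro sets_PiM_cong) auto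
  moreover have "splice_obs n \<Omega> \<theta> (\<lambda>_\<in>{1..n}. None) \<in> (\<Pi>\<^sub>M i\<in>\<Omega>. borel) \<rightarrow>\<^sub>M obs_space n"
    using splice_obs_measurable[OF measurable_const[OF blank_in_space] measurable_ident] by simp
  ultimately show ?thesis unfolding observe_eq by (simp cong: measurable_cong_sets)
qed

lemma prob_space_obs_law:
  assumes "prob_space \<nu>" "sets \<nu> = sets borel"
  shows "prob_space (obs_law \<nu> n \<Omega> \<theta>)"
  unfolding obs_law_def
  by (rule prob_space.prob_space_distr[OF prob_space_PiM observe_measurable]) (use assms in auto)

lemma algorithm_dominates:
  assumes \<Omega>: "\<Omega> \<subseteq> {1..n}" and A: "A \<in> sets (obs_space n)"
    and m: "0 < m" "\<And>z. pos_profile z \<le> m * proposal_density z"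
  shows "ennreal ((1 - (1 - accept_mass / m) ^ k) / accept_mass) ^ card \<Omega> * emeasure (obs_law (target_noise \<psi> \<sigma>) n \<Omega> \<theta>) A
    \<le> emeasure (obs_law source_noise n \<Omega> \<theta> \<bind> output_law n (algorithm m k \<Omega>)) A"
proof -
  define L where "L = sorted_list_of_set \<Omega>"
  have fin: "finite \<Omega>" using \<Omega> finite_subset by blast
  then have L: "distinct L" "set L = \<Omega>" "length L = card \<Omega>" "set L \<subseteq> {1..n}" using \<Omega> by (auto simp: L_def)
  let ?c = "ennreal ((1 - (1 - accept_mass / m) ^ k) / accept_mass)"
  let ?G = "indicator A :: (nat \<Rightarrow> real option) \<Rightarrow> ennreal"
  have G: "?G \<in> borel_measurable (obs_space n)" using A by measurable
  have F: "foldr entry_operator L ?G \<in> borel_measurable (obs_space n)"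
    using L G by (intro foldr_entry_operator_measurable)
  let ?h = "output_law n (algorithm m k \<Omega>)"
  note obs_src = observe_measurable[OF sets_source_noise, of n \<Omega> \<theta>]
  note obs_tgt = observe_measurable[OF sets_target_noise, of n \<Omega> \<theta>]
  have obs_space: "observe n \<Omega> \<theta> \<xi> \<in> space (obs_space n)" for \<xi>
    by (simp add: observe_def space_obs_space)
  have out: "emeasure (?h w) A = (\<integral>\<^sup>+t. ?G (snd t) \<partial>sem \<psi> \<sigma> n (algorithm m k \<Omega>) (\<lambda>_. 0, w))"
    if "w \<in> space (obs_space n)" for w
  proof -
    have snd: "snd \<in> sem \<psi> \<sigma> n (algorithm m k \<Omega>) (\<lambda>_. 0, w) \<rightarrow>\<^sub>M obs_space n"
      using vector_measurable measurable_cong_sets[OF sets_sem refl] that by (metis space_state_space)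
    then show ?thesis unfolding output_law_def
      using A G by (subst nn_integral_distr[OF snd, symmetric]) auto
  qed
  have "?c ^ card \<Omega> * emeasure (obs_law (target_noise \<psi> \<sigma>) n \<Omega> \<theta>) A
      = ?c ^ card \<Omega> * (\<integral>\<^sup>+\<xi>. ?G (observe n \<Omega> \<theta> \<xi>) \<partial>(\<Pi>\<^sub>M i\<in>\<Omega>. target_noise \<psi> \<sigma>))"
    unfolding obs_law_def using A G by (subst nn_integral_distr[OF obs_tgt, symmetric]) auto
  also have "\<dots> \<le> ?c ^ card \<Omega> * (\<integral>\<^sup>+\<xi>. foldr entry_operator L ?G (observe n \<Omega> \<theta> \<xi>) \<partial>(\<Pi>\<^sub>M i\<in>\<Omega>. source_noise))"
    unfolding observe_eq using nn_integral_source_operators_ge[OF L(1,4) G blank_in_space] L(2)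
    by (intro mult_left_mono) auto
  also have "\<dots> = (\<integral>\<^sup>+\<xi>. ?c ^ length L * foldr entry_operator L ?G (observe n \<Omega> \<theta> \<xi>) \<partial>(\<Pi>\<^sub>M i\<in>\<Omega>. source_noise))"
    using measurable_compose[OF obs_src F] L(3) by (simp add: nn_integral_cmult)
  also have "\<dots> \<le> (\<integral>\<^sup>+\<xi>. emeasure (?h (observe n \<Omega> \<theta> \<xi>)) A \<partial>(\<Pi>\<^sub>M i\<in>\<Omega>. source_noise))"
    unfolding out[OF obs_space] unfolding algorithm_def L_def[symmetric]
    by (intro nn_integral_mono nn_integral_program_ge L G m obs_space)
  also have "\<dots> = (\<integral>\<^sup>+w. emeasure (?h w) A \<partial>obs_law source_noise n \<Omega> \<theta>)"
    unfolding obs_law_def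
    using measurable_compose[OF measurable_prob_algebraD[OF output_law_measurable] measurable_emeasure_subprob_algebra[OF A]]
    by (subst nn_integral_distr[OF obs_src]) auto
  also have "\<dots> = emeasure (obs_law source_noise n \<Omega> \<theta> \<bind> ?h) A"
  proof (rule emeasure_bind[symmetric, OF _ _ A])
    show "?h \<in> obs_law source_noise n \<Omega> \<theta> \<rightarrow>\<^sub>M subprob_algebra (obs_space n)"
      unfolding obs_law_def using measurable_prob_algebraD[OF output_law_measurable] by simp
    show "space (obs_law source_noise n \<Omega> \<theta>) \<noteq> {}"
      using blank_in_space unfolding obs_law_def by auto
  qed
  finally show ?thesis .
qed

text \<open>The failure probability of an entry is at most exp (-P k/m), with P the mass of s^+.
  Since P \<ge> 1, the stated number of rounds makes it at most \<epsilon>, and 1 - c = (P - 1 + r)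
  / P is then at most \<epsilon> + \<tau>.\<close>

lemma tv_dist_algorithm:
  assumes \<Omega>: "\<Omega> \<subseteq> {1..n}" and m: "0 < m" "\<And>z. pos_profile z \<le> m * proposal_density z"
    and \<epsilon>: "0 < \<epsilon>" and k: "m * ln (1 / \<epsilon>) \<le> real k"
  shows "tv_dist (obs_law source_noise n \<Omega> \<theta> \<bind> output_law n (algorithm m k \<Omega>)) (obs_law (target_noise \<psi> \<sigma>) n \<Omega> \<theta>)
    \<le> real (card \<Omega>) * (\<epsilon> + tau \<psi> \<sigma>)"
proof -
  let ?P = accept_mass
  let ?p = "obs_law source_noise n \<Omega> \<theta> \<bind> output_law n (algorithm m k \<Omega>)"
  let ?q = "obs_law (target_noise \<psi> \<sigma>) n \<Omega> \<theta>"
  define r where "r = (1 - ?P / m) ^ k"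
  define c where "c = (1 - r) / ?P"
  have P: "1 \<le> ?P" "?P / m \<le> 1" using accept_mass_ge_1 accept_mass_le_envelope[OF m] by auto
  have r: "0 \<le> r" "r \<le> 1" using P m(1) by (auto simp: r_def power_le_one)
  have "r \<le> exp (- (?P / m)) ^ k"
    unfolding r_def using P exp_ge_add_one_self[of "- (?P / m)"] by (intro power_mono) auto
  also have "\<dots> = exp (- (?P * (real k / m)))" by (simp add: exp_of_nat_mult[symmetric] mult.commute)
  also have "\<dots> \<le> exp (- ln (1 / \<epsilon>))"
  proof -
    have "ln (1 / \<epsilon>) \<le> real k / m" using k m(1) by (simp add: pos_le_divide_eq mult.commute)
    also have "\<dots> \<le> ?P * (real k / m)" using P m(1) mult_right_mono[of 1 ?P "real k / m"] by simp
    finally show ?thesis by simp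
  qed
  also have "\<dots> = \<epsilon>" using \<epsilon> by (simp add: ln_div)
  finally have r_le: "r \<le> \<epsilon>" .
  have c: "0 \<le> c" "c \<le> 1" using r P by (auto simp: c_def pos_divide_le_eq)
  have "1 - c = (?P - 1 + r) / ?P" using P by (simp add: c_def field_simps)
  also have "\<dots> \<le> (?P - 1 + r) / 1" using P r by (intro divide_left_mono) auto
  also have "\<dots> \<le> \<epsilon> + tau \<psi> \<sigma>" using accept_mass_le r_le by simp
  finally have one_minus_c: "1 - c \<le> \<epsilon> + tau \<psi> \<sigma>" .
  have src: "obs_law source_noise n \<Omega> \<theta> \<in> space (prob_algebra (obs_space n))"
    using prob_space_obs_law[OF prob_space_source_noise sets_source_noise] by (simp add: space_prob_algebra obs_law_def)
  have prob_p: "prob_space ?p" by (rule prob_space_bind'[OF src output_law_measurable])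
  have prob_q: "prob_space ?q" by (rule prob_space_obs_law[OF prob_space_target_noise sets_target_noise])
  have sets_p: "sets ?p = sets (obs_space n)" by (rule sets_bind'[OF src output_law_measurable])
  have "tv_dist ?p ?q \<le> 1 - c ^ card \<Omega>"
  proof (rule tv_dist_le[OF prob_p prob_q])
    show "sets ?p = sets ?q" unfolding sets_p by (simp add: obs_law_def)
    show "c ^ card \<Omega> \<le> 1" using c by (simp add: power_le_one)
    fix A assume "A \<in> sets ?p"
    then have "A \<in> sets (obs_space n)" unfolding sets_p .
    from algorithm_dominates[OF \<Omega> this m, of k \<theta>]
    have "ennreal (c ^ card \<Omega> * measure ?q A) \<le> ennreal (measure ?p A)"
      using c prob_p prob_q unfolding r_def[symmetric] c_def[symmetric]
      by (simp add: ennreal_mult' ennreal_power finite_measure.emeasure_eq_measure prob_space.finite_measure)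
    then show "c ^ card \<Omega> * measure ?q A \<le> measure ?p A" by simp
  qed
  also have "\<dots> \<le> real (card \<Omega>) * (1 - c)"
    using Bernoulli_inequality[of "c - 1" "card \<Omega>"] c by (simp add: algebra_simps)
  also have "\<dots> \<le> real (card \<Omega>) * (\<epsilon> + tau \<psi> \<sigma>)" using one_minus_c by (intro mult_left_mono) auto
  finally show ?thesis .
qed

lemma run_time_block: "run_time T\<^sub>s T\<^sub>e (block cs) = sum_list (map (run_time T\<^sub>s T\<^sub>e) cs)"
  by (induction cs) (simp_all add: block_Cons)

text \<open>A round takes 21 elementary operations, one \<open>Eval\<close> and one unit for the
  loop; the additional 2 per entry are \<open>Load\<close> and \<open>Store\<close>.\<close>

lemma run_time_algorithm:
  "run_time T\<^sub>s T\<^sub>e (algorithm m k \<Omega>) = real (card \<Omega>) * (2 + real k * (22 + T\<^sub>e))"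
  unfolding algorithm_def run_time_block map_map
  by (simp add: comp_def sum_list_triv entry_def trial_def run_time_block)

end

theorem corollary2:
  shows "\<exists>C::real. \<forall>(\<psi>::real \<Rightarrow> real) (n::nat) (\<Omega>::nat set) (\<sigma>::real) (M::real) (\<epsilon>::real) (N::real).
    convex_on UNIV \<psi> \<longrightarrow> (\<forall>z. \<psi> differentiable (at z)) \<longrightarrow>
    has_bochner_integral lborel (\<lambda>z. exp (- \<psi> z)) 1 \<longrightarrow>
    has_bochner_integral lborel (\<lambda>z. z * exp (- \<psi> z)) 0 \<longrightarrow>
    has_bochner_integral lborel (\<lambda>z. z\<^sup>2 * exp (- \<psi> z)) 1 \<longrightarrow>
    1 \<le> n \<longrightarrow> \<Omega> \<subseteq> {1..n} \<longrightarrow>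
    0 < \<sigma> \<longrightarrow> tau \<psi> \<sigma> < 1 \<longrightarrow>
    ereal (2 * exp (\<psi> 0 / 2)) *
      (SUP z\<in>{z. ereal z \<le> kappa \<psi> \<sigma>}. ereal (exp (- \<psi> z / 2) * (1 - deriv \<psi> z / \<sigma>)))
      \<le> ereal M \<longrightarrow>
    0 < \<epsilon> \<longrightarrow> \<epsilon> < 1 \<longrightarrow>
    N = M * ln (2 / \<epsilon>) / (1 - tau \<psi> \<sigma>) \<longrightarrow>
    (\<exists>h\<in>obs_space n \<rightarrow>\<^sub>M prob_algebra (obs_space n).
       (\<exists>c. computes \<psi> \<sigma> n c h \<and>
          (\<forall>T\<^sub>s\<ge>1. \<forall>T\<^sub>e\<ge>1. run_time T\<^sub>s T\<^sub>e c \<le> C * (real (card \<Omega>) * N * (T\<^sub>s + T\<^sub>e)))) \<and>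
       (\<forall>\<theta>::nat \<Rightarrow> real.
          tv_dist (obs_law source_noise n \<Omega> \<theta> \<bind> h) (obs_law (target_noise \<psi> \<sigma>) n \<Omega> \<theta>)
            \<le> real (card \<Omega>) * (\<epsilon> + tau \<psi> \<sigma>)))"
proof (rule exI[of _ 187500], intro allI impI, goal_cases)
  case (1 \<psi> n \<Omega> \<sigma> M \<epsilon> N)
  interpret scaled_target \<psi> \<sigma> by unfold_locales (use 1 in auto)
  note M = pos_profile_le[OF 1(10)]
  define m where "m = 2500 * M"
  define l where "l = ln (2 / \<epsilon>)"
  define k where "k = nat \<lceil>m * l\<rceil>"
  have m: "0 < m" "\<And>z. pos_profile z \<le> m * proposal_density z"
    using M by (auto simp: m_def proposal_density_def)
  have m1: "1 \<le> m"
    using accept_mass_ge_1 accept_mass_le_envelope[OF m] m(1) by (simp add: pos_divide_le_eq)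
  \<comment> \<open>The 2 inside the logarithm keeps \<open>l\<close> away from 0 even for
    \<epsilon> near 1. With \<open>1 \<le> m\<close> this gives m l \<ge> 1/2, so rounding up to
    \<open>k\<close> costs at most a factor 3.\<close>
  have "ln 2 \<le> l" using 1(11,12) by (simp add: l_def field_simps)
  then have l: "1 / 2 \<le> l" using ln2_ge_two_thirds by simp
  have "1 * (1 / 2) \<le> m * l" using m1 l by (intro mult_mono) auto
  then have ml: "1 / 2 \<le> m * l" by simp
  have k_ge: "m * l \<le> real k" by (simp add: k_def real_nat_ceiling_ge)
  have k1: "1 \<le> real k" using k_ge ml by (cases k) auto
  have "real k \<le> m * l + 1" using ml by (simp add: k_def)
  also have "\<dots> \<le> 3 * (m * l)" using ml by linarith
  also have "\<dots> = 7500 * (M * l)" by (simp add: m_def)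
  also have "M * l \<le> N"
  proof -
    have "M * l / 1 \<le> M * l / (1 - tau \<psi> \<sigma>)"
      using 1(9) tau_nonneg M(1) l by (intro divide_left_mono) auto
    then show ?thesis using 1(13) by (simp add: l_def)
  qed
  finally have k_le: "real k \<le> 7500 * N" by simp
  let ?c = "algorithm m k \<Omega>"
  have "computes \<psi> \<sigma> n ?c (output_law n ?c)" by (simp add: computes_def output_law_def)
  moreover have "run_time T\<^sub>s T\<^sub>e ?c \<le> 187500 * (real (card \<Omega>) * N * (T\<^sub>s + T\<^sub>e))" if T: "1 \<le> T\<^sub>s" "1 \<le> T\<^sub>e" for T\<^sub>s T\<^sub>e
  proof -
    \<comment> \<open>At least one round is made, so the cost of loading and storing is absorbed
      into the rounds.\<close>
    have "2 + real k * (22 + T\<^sub>e) \<le> real k * 2 + real k * (22 + T\<^sub>e)" using k1 by simp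
    also have "\<dots> = real k * (24 + T\<^sub>e)" by (simp add: algebra_simps)
    \<comment> \<open>An evaluation costs at least 1, so 24 elementary operations cost at most 24
      evaluations; 7500 * 25 = 187500 is the universal constant, with 7500 = 3 * 2500.\<close>
    also have "\<dots> \<le> (7500 * N) * (25 * (T\<^sub>s + T\<^sub>e))" using k_le k1 T by (intro mult_mono) auto
    also have "\<dots> = 187500 * (N * (T\<^sub>s + T\<^sub>e))" by simp
    finally have "real (card \<Omega>) * (2 + real k * (22 + T\<^sub>e)) \<le> real (card \<Omega>) * (187500 * (N * (T\<^sub>s + T\<^sub>e)))"
      by (intro mult_left_mono) auto
    then show ?thesis unfolding run_time_algorithm by (simp only: mult_ac)
  qed
  moreover have "tv_dist (obs_law source_noise n \<Omega> \<theta> \<bind> output_law n ?c) (obs_law (target_noise \<psi> \<sigma>) n \<Omega> \<theta>)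
      \<le> real (card \<Omega>) * (\<epsilon> + tau \<psi> \<sigma>)" for \<theta>
  proof (rule tv_dist_algorithm[OF 1(7) m 1(11)])
    have "ln (1 / \<epsilon>) \<le> l" using 1(11) by (simp add: l_def divide_right_mono)
    then have "m * ln (1 / \<epsilon>) \<le> m * l" using m1 by (intro mult_left_mono) auto
    then show "m * ln (1 / \<epsilon>) \<le> real k" using k_ge by simp
  qed
  ultimately show ?case using output_law_measurable[of n ?c] by blast
qed

end
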